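(* Let $d\ge 3$, let $V$ be a $2d$-dimensional vector space over $\mathbb{F}_q$ provided with a nondegenerate symplectic form, and let $\mathbf{P}$ be the associated polar space $\mathrm{Sp}_{2d}(q)$. Let $U$ be (the set of points of) a totally isotropic $d$-space, let $\mathcal{H}$ be the set of hyperplanes of $U$, let $\mathbf{D}$ be a symmetric design on the point set $U$ with the parameters $2$-$\big(\frac{q^{d}-1}{q-1}, \frac{q^{d-1}-1}{q-1}, \frac{q^{d-2}-1}{q-1}\big)$, and let $\phi$ be a bijection from $\mathcal{H}$ to the set of blocks of $\mathbf{D}$. Then the graph $\Gamma_\phi$ satisfies the $4$-vertex condition.
   Context: The points of the symplectic polar space $\mathbf{P}$ are all $1$-dimensional subspaces of $V$; its lines are the totally isotropic $2$-dimensional subspaces. Let $P$ be its point set. For a point $x$, $x^\perp$ is the set of points collinear with (i.e. orthogonal to) $x$, including $x$ itself. Subspaces are identified with their sets of projective points, and "hyperplane of $U$" means $(d-1)$-dimensional subspace of $U$. For $y \in P\setminus U$ the set $y^\perp\cap U$ is a hyperplane of $U$. The image of $H$ under $\phi$ is written $H^\phi$, a block of $\mathbf{D}$, viewed as a subset of $U$. The graph $\Gamma_\phi$ has vertex set $P$, with adjacency as follows: (1) distinct vertices in $U$ are adjacent; (2) distinct vertices $x,y \notin U$ are adjacent if and only if $x \in y^\perp$; (3) vertices $x \in U$, $y \notin U$ are adjacent if and only if $x \in (y^\perp \cap U)^\phi$. A graph $\Gamma$ satisfies the $t$-vertex condition if, for all triples $(T,x_0,y_0)$ consisting of a $t$-vertex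 graph $T$ together with two distinct distinguished vertices $x_0,y_0$ of $T$, and all pairs of distinct vertices $x,y$ of $\Gamma$, the number of isomorphic copies of $T$ in $\Gamma$ (as induced subgraphs), where the isomorphism maps $x_0$ to $x$ and $y_0$ to $y$, does not depend on the choice of the pair $x,y$ but only on whether $x,y$ are adjacent or nonadjacent. *)

theory Defs
  imports Complex_Main
begin

section \<open>The symplectic polar space\<close>

text \<open>
  The vector space is the whole type \<open>'v\<close>, with scalar multiplication \<open>scale\<close> over the finite
  field \<open>'k\<close>.  A projective point is represented by the corresponding 1-dimensional subspace, as a
  set of vectors.
\<close>

definition symplectic_form ::
    "('k::field \<Rightarrow> 'v::ab_group_add \<Rightarrow> 'v) \<Rightarrow> ('v \<Rightarrow> 'v \<Rightarrow> 'k) \<Rightarrow> bool" where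
  "symplectic_form scale B \<longleftrightarrow>
     (\<forall>x. Vector_Spaces.linear scale (*) (\<lambda>y. B x y)) \<and>
     (\<forall>y. Vector_Spaces.linear scale (*) (\<lambda>x. B x y)) \<and>
     (\<forall>x. B x x = 0)"

definition nondegenerate :: "('v::ab_group_add \<Rightarrow> 'v \<Rightarrow> 'k::field) \<Rightarrow> bool" where
  "nondegenerate B \<longleftrightarrow> (\<forall>x. (\<forall>y. B x y = 0) \<longrightarrow> x = 0)"

definition totally_isotropic :: "('v \<Rightarrow> 'v \<Rightarrow> 'k::zero) \<Rightarrow> 'v set \<Rightarrow> bool" where
  "totally_isotropic B S \<longleftrightarrow> (\<forall>u\<in>S. \<forall>v\<in>S. B u v = 0)"

definition proj_points ::
    "('k::field \<Rightarrow> 'v::ab_group_add \<Rightarrow> 'v) \<Rightarrow> 'v set \<Rightarrow> 'v set set" where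
  "proj_points scale S =
     {x. module.subspace scale x \<and> vector_space.dim scale x = 1 \<and> x \<subseteq> S}"

text \<open>
  For points \<open>x\<close> and \<open>y\<close> of the polar space, collinear or equal means orthogonal.
\<close>

definition perp ::
    "('k::field \<Rightarrow> 'v::ab_group_add \<Rightarrow> 'v) \<Rightarrow> ('v \<Rightarrow> 'v \<Rightarrow> 'k) \<Rightarrow> 'v set \<Rightarrow> 'v set set" where
  "perp scale B x = {y \<in> proj_points scale UNIV. \<forall>u\<in>x. \<forall>v\<in>y. B u v = 0}"

text \<open>Hyperplanes of the subspace \<open>W\<close>, each given by its set of projective points.\<close>

definition hyperplanes ::
    "('k::field \<Rightarrow> 'v::ab_group_add \<Rightarrow> 'v) \<Rightarrow> 'v set \<Rightarrow> 'v set set set" where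
  "hyperplanes scale W =
     {proj_points scale S |S. module.subspace scale S \<and> S \<subseteq> W \<and>
        vector_space.dim scale S + 1 = vector_space.dim scale W}"


section \<open>Symmetric designs\<close>

text \<open>
  The blocks form a set of subsets of the point set.  Nothing is lost by this: two different blocks
  of a symmetric design with \<open>\<lambda> < k\<close> meet in exactly \<open>\<lambda>\<close> points, so repeated blocks cannot occur.
\<close>

definition two_design :: "'p set \<Rightarrow> 'p set set \<Rightarrow> nat \<Rightarrow> nat \<Rightarrow> nat \<Rightarrow> bool" where
  "two_design X Bs v k l \<longleftrightarrow>
     finite X \<and> card X = v \<and>
     (\<forall>b\<in>Bs. b \<subseteq> X \<and> card b = k) \<and>
     (\<forall>x\<in>X. \<forall>y\<in>X. x \<noteq> y \<longrightarrow> card {b \<in> Bs. x \<in> b \<and> y \<in> b} = l)"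

definition symmetric_design :: "'p set \<Rightarrow> 'p set set \<Rightarrow> nat \<Rightarrow> nat \<Rightarrow> nat \<Rightarrow> bool" where
  "symmetric_design X Bs v k l \<longleftrightarrow> two_design X Bs v k l \<and> card Bs = card X"


section \<open>Graphs and the \<open>t\<close>-vertex condition\<close>

definition simple_graph :: "'a set \<Rightarrow> ('a \<Rightarrow> 'a \<Rightarrow> bool) \<Rightarrow> bool" where
  "simple_graph X E \<longleftrightarrow>
     (\<forall>u v. E u v \<longrightarrow> u \<in> X \<and> v \<in> X \<and> u \<noteq> v \<and> E v u)"

definition induced_iso ::
    "('b \<Rightarrow> 'a) \<Rightarrow> 'b set \<Rightarrow> ('b \<Rightarrow> 'b \<Rightarrow> bool) \<Rightarrow> 'a set \<Rightarrow> ('a \<Rightarrow> 'a \<Rightarrow> bool) \<Rightarrow> bool" where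
  "induced_iso f Y F S E \<longleftrightarrow>
     bij_betw f Y S \<and> (\<forall>u\<in>Y. \<forall>v\<in>Y. F u v \<longleftrightarrow> E (f u) (f v))"

text \<open>
  An induced subgraph is determined by its vertex set, so the copies of the graph \<open>(Y, F)\<close> rooted at
  \<open>(x0, y0)\<close> are counted as vertex sets \<open>S\<close>.
\<close>

definition rooted_copies ::
    "'b set \<Rightarrow> ('b \<Rightarrow> 'b \<Rightarrow> bool) \<Rightarrow> 'b \<Rightarrow> 'b \<Rightarrow> 'a set \<Rightarrow> ('a \<Rightarrow> 'a \<Rightarrow> bool) \<Rightarrow> 'a \<Rightarrow> 'a \<Rightarrow> 'a set set"
  where
  "rooted_copies Y F x0 y0 X E x y =
     {S. S \<subseteq> X \<and> (\<exists>f. induced_iso f Y F S E \<and> f x0 = x \<and> f y0 = y)}"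

text \<open>
  The test graphs \<open>(Y, F)\<close> have natural numbers as vertices; up to isomorphism these are all finite
  graphs.
\<close>

definition vertex_condition :: "nat \<Rightarrow> 'a set \<Rightarrow> ('a \<Rightarrow> 'a \<Rightarrow> bool) \<Rightarrow> bool" where
  "vertex_condition t X E \<longleftrightarrow>
     (\<forall>(Y :: nat set) F x0 y0.
        finite Y \<and> card Y = t \<and> simple_graph Y F \<and> x0 \<in> Y \<and> y0 \<in> Y \<and> x0 \<noteq> y0 \<longrightarrow>
        (\<forall>x\<in>X. \<forall>y\<in>X. \<forall>x'\<in>X. \<forall>y'\<in>X.
           x \<noteq> y \<and> x' \<noteq> y' \<and> (E x y \<longleftrightarrow> E x' y') \<longrightarrow>
           card (rooted_copies Y F x0 y0 X E x y) = card (rooted_copies Y F x0 y0 X E x' y')))"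


section \<open>The graph \<open>\<Gamma>\<^sub>\<phi>\<close>\<close>

text \<open>The vertex set is \<open>proj_points scale UNIV\<close>; \<open>U\<close> is a set of points.\<close>

definition Gamma_adj ::
    "('k::field \<Rightarrow> 'v::ab_group_add \<Rightarrow> 'v) \<Rightarrow> ('v \<Rightarrow> 'v \<Rightarrow> 'k) \<Rightarrow> 'v set set \<Rightarrow>
     ('v set set \<Rightarrow> 'v set set) \<Rightarrow> 'v set \<Rightarrow> 'v set \<Rightarrow> bool" where
  "Gamma_adj scale B U \<phi> x y \<longleftrightarrow>
     x \<in> proj_points scale UNIV \<and> y \<in> proj_points scale UNIV \<and> x \<noteq> y \<and>
     (x \<in> U \<and> y \<in> U \<or>
      x \<notin> U \<and> y \<notin> U \<and> x \<in> perp scale B y \<or>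
      x \<in> U \<and> y \<notin> U \<and> x \<in> \<phi> (perp scale B y \<inter> U) \<or>
      x \<notin> U \<and> y \<in> U \<and> y \<in> \<phi> (perp scale B x \<inter> U))"

lemma symplectic_form_skew:
  assumes "symplectic_form scale B"
  shows "B x y = - B y x"
proof -
  have l: "Vector_Spaces.linear scale (*) (\<lambda>y. B x y)" "Vector_Spaces.linear scale (*) (\<lambda>x. B x y)"
    for x y using assms by (auto simp: symplectic_form_def)
  have addr: "B u (v + w) = B u v + B u w" and addl: "B (v + w) u = B v u + B w u" for u v w
    using l[THEN Vector_Spaces.linear.axioms(3), THEN module_hom.add] by auto
  have "B (x + y) (x + y) = 0" "B x x = 0" "B y y = 0"
    using assms by (auto simp: symplectic_form_def)
  then have "B x y + B y x = 0"
    by (simp add: addr addl add.commute)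
  then show ?thesis
    by (simp add: eq_neg_iff_add_eq_0)
qed

lemma simple_graph_Gamma:
  assumes "symplectic_form scale B"
  shows "simple_graph (proj_points scale UNIV) (Gamma_adj scale B U \<phi>)"
proof -
  have "B u v = 0 \<longleftrightarrow> B v u = 0" for u v
    using symplectic_form_skew[OF assms, of u v] by simp
  then have "x \<in> perp scale B y \<longleftrightarrow> y \<in> perp scale B x"
    if "x \<in> proj_points scale UNIV" "y \<in> proj_points scale UNIV" for x y
    using that unfolding perp_def by blast
  then show ?thesis
    unfolding simple_graph_def Gamma_adj_def by blast
qed

end

theory Submission
  imports Defs
begin

text \<open>
  By the criterion of Hestenes and Higman it suffices that the graph is strongly regular and that the
  number of edges among the common neighbours of two vertices depends only on their adjacency.
  Make adjacency reflexive. The common neighbours of \<open>x\<close> and \<open>y\<close> are split into those in \<open>U\<close> and those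
  outside, and the points \<open>z\<close> outside are grouped by the hyperplane \<open>z\<^sup>\<bottom> \<inter> U\<close>. The group sizes do not
  depend on the hyperplane, so the twist \<open>\<phi>\<close> enters the counts only through the design parameters,
  which are those of the design of hyperplanes of \<open>U\<close>; the only exceptional group is that of the
  hyperplane of \<open>x\<close> or \<open>y\<close> itself. For \<open>x, y \<notin> U\<close> the count equals the one in the polar space, which is
  computed directly.
\<close>

section \<open>The criterion of Hestenes and Higman\<close>

text \<open>Why the criterion works: each of the two further vertices of a rooted four-vertex graph
  lies in one of four cells, by its adjacency to the two roots. Strong regularity leaves one unknown
  per row in the table of edges between cells, and symmetry of the table reduces these unknowns to
  the count among the common neighbours.

  Why loops: perps in the polar space are then full projective subspaces, and two points have
  \<open>m2\<close> common neighbours whether adjacent or not. Adjacency shows only in the ordered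
  pairs inside, through the excess \<open>(q + 1) * (q * e * e)\<close>: a totally isotropic line
  has q+1 points, and each of them adds q^(2d-3) pairs.

  The obstacle: \<phi> preserves no incidence, since \<open>\<phi> H\<close> need not have anything
  to do with \<open>H\<close>. All sums are therefore arranged so that only sizes of images, sizes
  of their pairwise intersections, and numbers of images through one or two points occur. The
  intersection sizes are not among the design axioms; they come from a variance argument.\<close>

definition cell :: "'a set \<Rightarrow> ('a \<Rightarrow> 'a \<Rightarrow> bool) \<Rightarrow> 'a \<Rightarrow> 'a \<Rightarrow> bool \<Rightarrow> bool \<Rightarrow> 'a set" where
  "cell X E x y a b = {z \<in> X - {x, y}. E x z = a \<and> E y z = b}"

definition cell_edges ::
    "'a set \<Rightarrow> ('a \<Rightarrow> 'a \<Rightarrow> bool) \<Rightarrow> 'a \<Rightarrow> 'a \<Rightarrow> bool \<times> bool \<Rightarrow> bool \<times> bool \<Rightarrow> ('a \<times> 'a) set" where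
  "cell_edges X E x y s t =
     {(z, w). z \<in> cell X E x y (fst s) (snd s) \<and> w \<in> cell X E x y (fst t) (snd t) \<and> E z w}"

text \<open>The values \<open>c True\<close> and \<open>c False\<close> are the usual \<lambda> and
  \<mu> of a strongly regular graph. Since ordered pairs are counted, \<open>e\<close> is twice the
  number of edges among the common neighbours.\<close>

locale regular_pairs =
  fixes X :: "'a set" and E :: "'a \<Rightarrow> 'a \<Rightarrow> bool" and k :: nat and c e :: "bool \<Rightarrow> nat"
  assumes finite_X: "finite X"
    and graph: "simple_graph X E"
    and degree: "x \<in> X \<Longrightarrow> card {z. E x z} = k"
    and common: "x \<in> X \<Longrightarrow> y \<in> X \<Longrightarrow> x \<noteq> y \<Longrightarrow> card {z. E x z \<and> E y z} = c (E x y)"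
    and common_edges: "x \<in> X \<Longrightarrow> y \<in> X \<Longrightarrow> x \<noteq> y \<Longrightarrow>
      card {(z, w). E x z \<and> E y z \<and> E x w \<and> E y w \<and> E z w} = e (E x y)"
begin

lemma adj_sym: "E u v \<longleftrightarrow> E v u"
  and adj_irrefl [simp]: "\<not> E u u"
  and adj_in: "E u v \<Longrightarrow> u \<in> X" "E u v \<Longrightarrow> v \<in> X"
  using graph unfolding simple_graph_def by blast+

lemma finite_cell [simp]: "finite (cell X E x y a b)"
  using finite_X by (simp add: cell_def)

lemma finite_cell_edges [simp]: "finite (cell_edges X E x y s t)"
  by (rule finite_subset[of _ "X \<times> X"]) (auto simp: cell_edges_def finite_X dest: adj_in)

lemma card_cells:
  assumes "x \<in> X" "y \<in> X" "x \<noteq> y"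
  shows "card (cell X E x y True True) = c (E x y)"
    and "card (cell X E x y True True) + card (cell X E x y True False) + of_bool (E x y) = k"
    and "card (cell X E x y True True) + card (cell X E x y False True) + of_bool (E x y) = k"
    and "card (cell X E x y True True) + card (cell X E x y True False)
       + card (cell X E x y False True) + card (cell X E x y False False) + 2 = card X"
proof -
  let ?C = "cell X E x y"
  have "?C True True = {z. E x z \<and> E y z}"
    by (auto simp: cell_def dest: adj_in)
  then show "card (?C True True) = c (E x y)"
    using common[OF assms] by simp
  have "{z. E x z} = (?C True True \<union> ?C True False) \<union> (if E x y then {y} else {})"
    using assms by (auto simp: cell_def dest: adj_in)
  moreover have "card \<dots> = card (?C True True) + card (?C True False) + of_bool (E x y)"
    by (subst card_Un_disjoint, simp, simp, force simp: cell_def)+ (simp add: of_bool_def)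
  ultimately show "card (?C True True) + card (?C True False) + of_bool (E x y) = k"
    using degree[OF assms(1)] by simp
  have "{z. E y z} = (?C True True \<union> ?C False True) \<union> (if E x y then {x} else {})"
    using assms adj_sym[of x y] by (auto simp: cell_def dest: adj_in)
  moreover have "card \<dots> = card (?C True True) + card (?C False True) + of_bool (E x y)"
    by (subst card_Un_disjoint, simp, simp, force simp: cell_def)+ (simp add: of_bool_def)
  ultimately show "card (?C True True) + card (?C False True) + of_bool (E x y) = k"
    using degree[OF assms(2)] by simp
  have "X = ?C True True \<union> ?C True False \<union> ?C False True \<union> ?C False False \<union> {x, y}"
    using assms by (auto simp: cell_def)
  moreover have "card \<dots> = card (?C True True) + card (?C True False)
       + card (?C False True) + card (?C False False) + card {x, y}"
    by (subst card_Un_disjoint, simp, simp, force simp: cell_def)+ simp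
  ultimately show "card (?C True True) + card (?C True False)
       + card (?C False True) + card (?C False False) + 2 = card X"
    using assms by simp
qed

lemma card_cell_cong:
  assumes "x \<in> X" "y \<in> X" "x \<noteq> y" "x' \<in> X" "y' \<in> X" "x' \<noteq> y'" "E x y = E x' y'"
  shows "card (cell X E x y a b) = card (cell X E x' y' a b)"
proof -
  note c = card_cells[OF assms(1-3)] card_cells[OF assms(4-6)]
  have 1: "card (cell X E x y True True) = card (cell X E x' y' True True)"
    using c(1,5) assms(7) by simp
  have 2: "card (cell X E x y True False) = card (cell X E x' y' True False)"
    using c(2,6) 1 assms(7) by simp
  have 3: "card (cell X E x y False True) = card (cell X E x' y' False True)"
    using c(3,7) 1 assms(7) by simp
  have 4: "card (cell X E x y False False) = card (cell X E x' y' False False)"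
    using c(4,8) 1 2 3 by simp
  show ?thesis
    using 1 2 3 4 by (cases a; cases b) simp_all
qed

lemma cell_edges_eq_Sigma:
  "cell_edges X E x y s t =
     (SIGMA z:cell X E x y (fst s) (snd s). {w \<in> cell X E x y (fst t) (snd t). E z w})"
  by (auto simp: cell_edges_def)

lemma card_cell_edges:
  "card (cell_edges X E x y s t) =
     (\<Sum>z\<in>cell X E x y (fst s) (snd s). card {w \<in> cell X E x y (fst t) (snd t). E z w})"
  unfolding cell_edges_eq_Sigma by (rule card_SigmaI) auto

lemma card_cell_edges_commute:
  "card (cell_edges X E x y s t) = card (cell_edges X E x y t s)"
  by (rule bij_betw_same_card[of prod.swap])
     (auto simp: bij_betw_def inj_on_def cell_edges_def image_iff adj_sym)

text \<open>The common neighbours of \<open>x\<close> and \<open>z\<close> split by adjacency to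
  \<open>y\<close>, and likewise with the roots exchanged. The \<open>of_bool\<close> terms account
  for the roots, which belong to no cell.\<close>

lemma card_nbrs_in_cells:
  assumes xy: "x \<in> X" "y \<in> X" "x \<noteq> y" and z: "z \<in> cell X E x y a b"
  defines "N \<equiv> \<lambda>p r. card {w \<in> cell X E x y p r. E z w}"
  shows "N True True + N True False + of_bool (E x y \<and> b) = c a"
    and "N True True + N False True + of_bool (E x y \<and> a) = c b"
    and "N True True + N True False + N False True + N False False + of_bool a + of_bool b = k"
proof -
  let ?D = "\<lambda>p r. {w \<in> cell X E x y p r. E z w}"
  have z': "z \<in> X" "z \<noteq> x" "z \<noteq> y" "E x z = a" "E y z = b" "E z x = a" "E z y = b"
    using z by (auto simp: cell_def adj_sym)
  have "{w. E x w \<and> E z w} = (?D True True \<union> ?D True False) \<union> (if E x y \<and> b then {y} else {})"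
    using xy z' by (auto simp: cell_def dest: adj_in)
  moreover have "card \<dots> = N True True + N True False + of_bool (E x y \<and> b)"
    unfolding N_def
    by (subst card_Un_disjoint, simp, simp, force simp: cell_def)+ (simp add: of_bool_def)
  ultimately show "N True True + N True False + of_bool (E x y \<and> b) = c a"
    using common[of x z] xy z' by simp
  have "{w. E y w \<and> E z w} = (?D True True \<union> ?D False True) \<union> (if E x y \<and> a then {x} else {})"
    using xy z' adj_sym[of x y] by (auto simp: cell_def dest: adj_in)
  moreover have "card \<dots> = N True True + N False True + of_bool (E x y \<and> a)"
    unfolding N_def
    by (subst card_Un_disjoint, simp, simp, force simp: cell_def)+ (simp add: of_bool_def)
  ultimately show "N True True + N False True + of_bool (E x y \<and> a) = c b"
    using common[of y z] xy z' by simp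
  have "{w. E z w} = ?D True True \<union> ?D True False \<union> ?D False True \<union> ?D False False
      \<union> {w \<in> {x, y}. E z w}"
    using xy by (auto simp: cell_def dest: adj_in)
  moreover have "card \<dots> = N True True + N True False + N False True + N False False
      + card {w \<in> {x, y}. E z w}"
    unfolding N_def
    by (subst card_Un_disjoint, simp, simp, force simp: cell_def)+ simp
  moreover have "card {w \<in> {x, y}. E z w} = of_bool a + of_bool b"
  proof -
    have "{w \<in> {x, y}. E z w} = (if a then {x} else {}) \<union> (if b then {y} else {})"
      using z' by auto
    then show ?thesis
      using xy(3) by simp
  qed
  ultimately show "N True True + N True False + N False True + N False False
      + of_bool a + of_bool b = k"
    using degree[OF z'(1)] by (simp only: add.assoc)
qed

lemma card_cell_edges_sums:
  assumes xy: "x \<in> X" "y \<in> X" "x \<noteq> y"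
  defines "n \<equiv> \<lambda>s p r. card (cell_edges X E x y s (p, r))"
    and "m \<equiv> \<lambda>s. card (cell X E x y (fst s) (snd s))"
  shows "n s True True + n s True False + m s * of_bool (E x y \<and> snd s) = m s * c (fst s)"
    and "n s True True + n s False True + m s * of_bool (E x y \<and> fst s) = m s * c (snd s)"
    and "n s True True + n s True False + n s False True + n s False False
           + m s * (of_bool (fst s) + of_bool (snd s)) = m s * k"
proof -
  let ?C = "cell X E x y (fst s) (snd s)"
  note nb = card_nbrs_in_cells[OF xy, of _ "fst s" "snd s"]
  show "n s True True + n s True False + m s * of_bool (E x y \<and> snd s) = m s * c (fst s)"
    using sum.cong[OF refl nb(1), of ?C "\<lambda>z. z"]
    by (simp add: n_def m_def card_cell_edges sum.distrib)
  show "n s True True + n s False True + m s * of_bool (E x y \<and> fst s) = m s * c (snd s)"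
    using sum.cong[OF refl nb(2), of ?C "\<lambda>z. z"]
    by (simp add: n_def m_def card_cell_edges sum.distrib)
  show "n s True True + n s True False + n s False True + n s False False
           + m s * (of_bool (fst s) + of_bool (snd s)) = m s * k"
    using sum.cong[OF refl nb(3), of ?C "\<lambda>z. z"]
    by (simp add: n_def m_def card_cell_edges sum.distrib algebra_simps)
qed

text \<open>For a fixed first cell, three linear equations bind the four numbers of edges into the
  cells, so the entry for \<open>(True, True)\<close> determines the row. The first row is known
  from \<open>common_edges\<close>.\<close>

lemma card_cell_edges_cong:
  assumes xy: "x \<in> X" "y \<in> X" "x \<noteq> y" and xy': "x' \<in> X" "y' \<in> X" "x' \<noteq> y'"
    and E: "E x y = E x' y'"
  shows "card (cell_edges X E x y s t) = card (cell_edges X E x' y' s t)"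
proof -
  let ?n = "\<lambda>a b p r. card (cell_edges X E x y (a, b) (p, r))"
  let ?n' = "\<lambda>a b p r. card (cell_edges X E x' y' (a, b) (p, r))"
  note m = card_cell_cong[OF xy xy' E]
  note eq1 = card_cell_edges_sums(1)[OF xy, of "(a, b)" for a b, simplified]
    card_cell_edges_sums(1)[OF xy', of "(a, b)" for a b, simplified, folded E m]
  note eq2 = card_cell_edges_sums(2)[OF xy, of "(a, b)" for a b, simplified]
    card_cell_edges_sums(2)[OF xy', of "(a, b)" for a b, simplified, folded E m]
  note eq3 = card_cell_edges_sums(3)[OF xy, of "(a, b)" for a b, simplified]
    card_cell_edges_sums(3)[OF xy', of "(a, b)" for a b, simplified, folded E m]
  have comm: "?n a b p r = ?n p r a b" "?n' a b p r = ?n' p r a b" for a b p r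
    by (rule card_cell_edges_commute)+
  have edges: "cell_edges X E u v (True, True) (True, True) =
      {(z, w). E u z \<and> E v z \<and> E u w \<and> E v w \<and> E z w}" for u v
    by (auto simp: cell_edges_def cell_def dest: adj_in)
  have row: "?n a b p r = ?n' a b p r" if "?n a b True True = ?n' a b True True" for a b p r
  proof -
    have 1: "?n a b True False = ?n' a b True False"
      using eq1(1)[of a b] eq1(2)[of a b] that by linarith
    have 2: "?n a b False True = ?n' a b False True"
      using eq2(1)[of a b] eq2(2)[of a b] that by linarith
    have 3: "?n a b False False = ?n' a b False False"
      using eq3(1)[of a b] eq3(2)[of a b] that 1 2 by linarith
    show ?thesis
      using that 1 2 3 by (cases p; cases r) simp_all
  qed
  have "?n True True True True = ?n' True True True True"
    using common_edges[OF xy] common_edges[OF xy'] E by (simp add: edges)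
  then have "?n True True p r = ?n' True True p r" for p r
    by (rule row)
  \<comment> \<open>By symmetry the known first row is also the first column, which supplies the
    missing entry of every other row.\<close>
  then have "?n a b True True = ?n' a b True True" for a b
    using comm by metis
  then have "?n a b p r = ?n' a b p r" for a b p r
    by (rule row)
  then show ?thesis
    by (cases s; cases t) simp
qed

section \<open>From edges between cells to rooted four-vertex subgraphs\<close>

definition cell_pairs :: "'a \<Rightarrow> 'a \<Rightarrow> bool \<times> bool \<Rightarrow> bool \<times> bool \<Rightarrow> bool \<Rightarrow> ('a \<times> 'a) set" where
  "cell_pairs x y s t p =
     {(z, w). z \<in> cell X E x y (fst s) (snd s) \<and> w \<in> cell X E x y (fst t) (snd t)
        \<and> z \<noteq> w \<and> E z w = p}"

text \<open>Nonadjacent pairs are what remains of the product of two cells after removing the edges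
  and, if the cells coincide, the diagonal.\<close>

lemma card_cell_pairs_cong:
  assumes xy: "x \<in> X" "y \<in> X" "x \<noteq> y" and xy': "x' \<in> X" "y' \<in> X" "x' \<noteq> y'"
    and E: "E x y = E x' y'"
  shows "card (cell_pairs x y s t p) = card (cell_pairs x' y' s t p)"
proof (cases p)
  case True
  then have "cell_pairs u v s t p = cell_edges X E u v s t" for u v
    by (auto simp: cell_pairs_def cell_edges_def)
  then show ?thesis
    using card_cell_edges_cong[OF assms] by simp
next
  case False
  let ?C = "\<lambda>u v s. cell X E u v (fst s) (snd s)"
  have "card (?C u v s) * card (?C u v t) = card (cell_pairs u v s t p)
      + card (cell_edges X E u v s t) + of_bool (s = t) * card (?C u v s)" for u v
  proof -
    have "?C u v s \<times> ?C u v t = cell_pairs u v s t p \<union> cell_edges X E u v s t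
        \<union> (if s = t then (\<lambda>z. (z, z)) ` ?C u v s else {})"
      using False by (auto simp: cell_pairs_def cell_edges_def cell_def prod_eq_iff)
    moreover have "card \<dots> = card (cell_pairs u v s t p)
      + card (cell_edges X E u v s t) + card (if s = t then (\<lambda>z. (z, z)) ` ?C u v s else {})"
    proof -
      have "finite (cell_pairs u v s t p)"
        by (rule finite_subset[of _ "?C u v s \<times> ?C u v t"]) (auto simp: cell_pairs_def)
      then show ?thesis
        using False
        by (subst card_Un_disjoint, simp, simp, force simp: cell_pairs_def cell_edges_def)+ simp
    qed
    moreover have "card (if s = t then (\<lambda>z. (z, z)) ` ?C u v s else {}) = of_bool (s = t) * card (?C u v s)"
      by (simp add: card_image inj_on_def)
    ultimately show ?thesis
      by (simp only: card_cartesian_product[symmetric])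
  qed
  from this[of x y] this[of x' y'] show ?thesis
    using card_cell_edges_cong[OF assms, of s t] card_cell_cong[OF assms] by simp
qed

end

lemma card_unordered_image:
  fixes A :: "('a \<times> 'a) set"
  assumes "finite A" "\<And>z w. (z, w) \<in> A \<Longrightarrow> z \<noteq> w" "\<And>z w. (z, w) \<in> A \<Longrightarrow> (w, z) \<in> A"
  shows "2 * card ((\<lambda>(z, w). {z, w}) ` A) = card A"
proof -
  let ?g = "\<lambda>(z, w). {z, w}"
  have fib: "card {p \<in> A. ?g p = S} = 2" if S: "S \<in> ?g ` A" for S
  proof -
    obtain z w where zw: "(z, w) \<in> A" "S = {z, w}"
      using S by auto
    then have "{p \<in> A. ?g p = S} = {(z, w), (w, z)}"
      using assms(3) by (auto simp: doubleton_eq_iff)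
    then show ?thesis
      using assms(2)[OF zw(1)] by simp
  qed
  have "card A = (\<Sum>S\<in>?g ` A. card {p \<in> A. ?g p = S})"
    using sum.image_gen[OF assms(1), of "\<lambda>_. 1::nat" ?g] by simp
  also have "\<dots> = (\<Sum>S\<in>?g ` A. 2)"
    by (rule sum.cong[OF refl fib])
  finally show ?thesis
    by simp
qed

context regular_pairs
begin

text \<open>A copy is fixed by the images of the two non-root vertices; their adjacencies to the
  roots say in which cells these images lie.\<close>

lemma rooted_copies_eq_image:
  assumes Y: "Y = {x0, y0, u, v}" "card Y = 4" and F: "simple_graph Y F"
    and xy: "x \<in> X" "y \<in> X" "x \<noteq> y" and E: "F x0 y0 = E x y"
  shows "rooted_copies Y F x0 y0 X E x y =
    (\<lambda>S. {x, y} \<union> S) ` (\<lambda>(z, w). {z, w}) ` cell_pairs x y (F x0 u, F y0 u) (F x0 v, F y0 v) (F u v)"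
    (is "_ = ?R")
proof -
  have dist: "x0 \<noteq> y0" "x0 \<noteq> u" "x0 \<noteq> v" "y0 \<noteq> u" "y0 \<noteq> v" "u \<noteq> v"
    using Y by (auto simp: card_insert_if split: if_splits)
  have Fs: "F a b = F b a" "\<not> F a a" for a b
    using F unfolding simple_graph_def by blast+
  show ?thesis
  proof (intro equalityI subsetI)
    fix S assume "S \<in> rooted_copies Y F x0 y0 X E x y"
    then obtain f where S: "S \<subseteq> X" and f: "bij_betw f Y S" "\<forall>a\<in>Y. \<forall>b\<in>Y. F a b \<longleftrightarrow> E (f a) (f b)"
      "f x0 = x" "f y0 = y"
      by (auto simp: rooted_copies_def induced_iso_def)
    have inj: "f a = f b \<longleftrightarrow> a = b" if "a \<in> Y" "b \<in> Y" for a b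
      using f(1) that by (auto simp: bij_betw_def inj_on_def)
    have SY: "S = {x, y} \<union> {f u, f v}"
      using f(1,3,4) Y(1) by (auto simp: bij_betw_def)
    have "f u \<noteq> x" "f u \<noteq> y" "f v \<noteq> x" "f v \<noteq> y" "f u \<noteq> f v"
      using inj f(3,4) Y(1) dist by (metis insertCI)+
    moreover have "E x (f u) = F x0 u" "E y (f u) = F y0 u" "E x (f v) = F x0 v"
        "E y (f v) = F y0 v" "E (f u) (f v) = F u v"
      using f(2,3,4) Y(1) by auto
    moreover have "f u \<in> X" "f v \<in> X"
      using S SY by auto
    ultimately have "(f u, f v) \<in> cell_pairs x y (F x0 u, F y0 u) (F x0 v, F y0 v) (F u v)"
      by (auto simp: cell_pairs_def cell_def)
    then show "S \<in> ?R"
      unfolding SY by (intro imageI) (auto intro!: image_eqI)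
  next
    fix S assume "S \<in> ?R"
    then obtain z w where zw: "(z, w) \<in> cell_pairs x y (F x0 u, F y0 u) (F x0 v, F y0 v) (F u v)"
      and S: "S = {x, y, z, w}"
      by auto
    \<comment> \<open>The default value \<open>x\<close> serves \<open>x0\<close>, the only vertex
      of \<open>Y\<close> not updated explicitly.\<close>
    define f where "f = (\<lambda>_. x)(y0 := y, u := z, v := w)"
    have f: "f x0 = x" "f y0 = y" "f u = z" "f v = w"
      using dist by (auto simp: f_def)
    have zw': "z \<in> X" "w \<in> X" "z \<noteq> x" "z \<noteq> y" "w \<noteq> x" "w \<noteq> y" "z \<noteq> w" 
      "E x z = F x0 u" "E y z = F y0 u" "E x w = F x0 v" "E y w = F y0 v" "E z w = F u v"
      using zw by (auto simp: cell_pairs_def cell_def)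
    have "bij_betw f Y S"
      unfolding bij_betw_def inj_on_def Y(1) S using f dist zw' xy by auto
    moreover have "\<forall>a\<in>Y. \<forall>b\<in>Y. F a b \<longleftrightarrow> E (f a) (f b)"
      unfolding Y(1) using f zw' E Fs adj_sym by (simp; metis)
    ultimately show "S \<in> rooted_copies Y F x0 y0 X E x y"
      using f zw' xy unfolding rooted_copies_def induced_iso_def S by blast
  qed
qed

text \<open>If \<open>u\<close> and \<open>v\<close> have the same type over the roots, they can be
  interchanged and each copy arises from two ordered pairs; otherwise the cells tell the two images
  apart.\<close>

lemma card_rooted_copies:
  assumes Y: "Y = {x0, y0, u, v}" "card Y = 4" and F: "simple_graph Y F"
    and xy: "x \<in> X" "y \<in> X" "x \<noteq> y" and E: "F x0 y0 = E x y"
  shows "(if (F x0 u, F y0 u) = (F x0 v, F y0 v) then 2 else 1) * card (rooted_copies Y F x0 y0 X E x y)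
    = card (cell_pairs x y (F x0 u, F y0 u) (F x0 v, F y0 v) (F u v))"
proof -
  let ?g = "\<lambda>(z, w). {z, w}" and ?s = "(F x0 u, F y0 u)" and ?t = "(F x0 v, F y0 v)"
  let ?A = "cell_pairs x y ?s ?t (F u v)"
  have "?A \<subseteq> X \<times> X"
    by (auto simp: cell_pairs_def cell_def)
  then have fin: "finite ?A"
    using finite_X finite_subset by blast
  have disj: "S \<inter> {x, y} = {}" if "S \<in> ?g ` ?A" for S
    using that by (auto simp: cell_pairs_def cell_def)
  have "inj_on (\<lambda>S. {x, y} \<union> S) (?g ` ?A)"
  proof (rule inj_on_inverseI[where g = "\<lambda>T. T - {x, y}"])
    fix S assume "S \<in> ?g ` ?A"
    from disj[OF this] show "({x, y} \<union> S) - {x, y} = S"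
      by blast
  qed
  then have img: "card (rooted_copies Y F x0 y0 X E x y) = card (?g ` ?A)"
    unfolding rooted_copies_eq_image[OF assms] by (rule card_image)
  show ?thesis
  proof (cases "?s = ?t")
    case True
    then have "2 * card (?g ` ?A) = card ?A"
      by (intro card_unordered_image[OF fin]) (auto simp: cell_pairs_def adj_sym)
    then show ?thesis
      using True img by simp
  next
    case False
    have "inj_on ?g ?A"
      by (rule inj_onI) (use False in \<open>auto simp: cell_pairs_def cell_def doubleton_eq_iff\<close>)
    then show ?thesis
      unfolding if_not_P[OF False] img by (simp add: card_image)
  qed
qed

theorem four_vertex_condition: "vertex_condition 4 X E"
  unfolding vertex_condition_def
proof (intro allI impI ballI, elim conjE)
  fix Y :: "nat set" and F x0 y0 x y x' y'
  assume Y: "finite Y" "card Y = 4" "x0 \<in> Y" "y0 \<in> Y" "x0 \<noteq> y0" and F: "simple_graph Y F"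
    and xy: "x \<in> X" "y \<in> X" "x \<noteq> y" and xy': "x' \<in> X" "y' \<in> X" "x' \<noteq> y'"
    and E: "E x y \<longleftrightarrow> E x' y'"
  have "card (Y - {x0, y0}) = 2"
    using Y by (subst card_Diff_subset) auto
  then obtain u v where "Y - {x0, y0} = {u, v}"
    by (auto simp: card_2_iff)
  with Y have Yuv: "Y = {x0, y0, u, v}"
    by auto
  show "card (rooted_copies Y F x0 y0 X E x y) = card (rooted_copies Y F x0 y0 X E x' y')"
  proof (cases "F x0 y0 = E x y")
    case True
    then show ?thesis
      using card_rooted_copies[OF Yuv Y(2) F xy True] card_rooted_copies[OF Yuv Y(2) F xy'] E
        card_cell_pairs_cong[OF xy xy' E] by (simp split: if_splits)
  next
    case False
    then have "rooted_copies Y F x0 y0 X E x y = {}" "rooted_copies Y F x0 y0 X E x' y' = {}"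
      using Y E by (auto simp: rooted_copies_def induced_iso_def)
    then show ?thesis
      by simp
  qed
qed

end

section \<open>Symmetric designs\<close>

lemma sum_card_filter_swap:
  assumes "finite A" "finite C"
  shows "(\<Sum>a\<in>A. card {c \<in> C. r a c}) = (\<Sum>c\<in>C. card {a \<in> A. r a c})"
proof -
  have "(\<Sum>a\<in>A. card {c \<in> C. r a c}) = (\<Sum>a\<in>A. \<Sum>c\<in>C. of_bool (r a c))"
    using assms by (simp add: Int_def)
  also have "\<dots> = (\<Sum>c\<in>C. \<Sum>a\<in>A. of_bool (r a c))"
    by (rule sum.swap)
  also have "\<dots> = (\<Sum>c\<in>C. card {a \<in> A. r a c})"
    using assms by (simp add: Int_def)
  finally show ?thesis .
qed

lemma two_design_finite_blocks:
  assumes "two_design X Bs v k l"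
  shows "finite Bs"
  by (rule finite_subset[of _ "Pow X"]) (use assms in \<open>auto simp: two_design_def\<close>)

text \<open>Double counting of the pairs \<open>(b, y)\<close> with \<open>y \<noteq> x\<close> and
  both points in \<open>b\<close>.\<close>

lemma two_design_replication:
  assumes D: "two_design X Bs v k l" and x: "x \<in> X"
  shows "card {b \<in> Bs. x \<in> b} * (k - 1) = l * (v - 1)"
proof -
  have X: "finite X" "card X = v" and b: "\<And>b. b \<in> Bs \<Longrightarrow> b \<subseteq> X \<and> card b = k"
    and l: "\<And>y. y \<in> X \<Longrightarrow> x \<noteq> y \<Longrightarrow> card {b \<in> Bs. x \<in> b \<and> y \<in> b} = l"
    using D x by (auto simp: two_design_def)
  let ?Bx = "{b \<in> Bs. x \<in> b}"
  have "card ?Bx * (k - 1) = (\<Sum>b\<in>?Bx. card {y \<in> X - {x}. y \<in> b})"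
  proof -
    have "card {y \<in> X - {x}. y \<in> b} = k - 1" if "b \<in> ?Bx" for b
    proof -
      have "{y \<in> X - {x}. y \<in> b} = b - {x}"
        using that b by auto
      then show ?thesis
        using that b by auto
    qed
    then show ?thesis
      by simp
  qed
  also have "\<dots> = (\<Sum>y\<in>X - {x}. card {b \<in> ?Bx. y \<in> b})"
    using X two_design_finite_blocks[OF D] by (intro sum_card_filter_swap) auto
  also have "\<dots> = (\<Sum>y\<in>X - {x}. l)"
    by (rule sum.cong) (use l in \<open>auto simp: conj_assoc\<close>)
  also have "\<dots> = l * (v - 1)"
    using X x by simp
  finally show ?thesis .
qed

text \<open>The hypothesis \<open>lv\<close> forces the replication number to be \<open>k\<close>.
  For the intersections, fix a block \<open>b\<close>: the first two moments of
  \<open>card (b \<inter> b')\<close> over the other blocks are known, and they make the variance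
  around \<open>l\<close> vanish.\<close>

lemma symmetric_design_dual:
  assumes D: "symmetric_design X Bs v k l" and k: "1 < k" and lv: "l * (v - 1) = k * (k - 1)"
  shows symmetric_design_replication: "\<And>x. x \<in> X \<Longrightarrow> card {b \<in> Bs. x \<in> b} = k"
    and symmetric_design_intersection:
      "\<And>b b'. b \<in> Bs \<Longrightarrow> b' \<in> Bs \<Longrightarrow> b \<noteq> b' \<Longrightarrow> card (b \<inter> b') = l"
proof -
  have D': "two_design X Bs v k l" and cB: "card Bs = v"
    using D by (auto simp: symmetric_design_def two_design_def)
  have X: "finite X" "card X = v" and bl: "\<And>b. b \<in> Bs \<Longrightarrow> b \<subseteq> X \<and> card b = k"
    and l: "\<And>x y. x \<in> X \<Longrightarrow> y \<in> X \<Longrightarrow> x \<noteq> y \<Longrightarrow> card {b \<in> Bs. x \<in> b \<and> y \<in> b} = l"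
    using D' by (auto simp: two_design_def)
  note finB = two_design_finite_blocks[OF D']
  show r: "card {b \<in> Bs. x \<in> b} = k" if "x \<in> X" for x
    using two_design_replication[OF D' that] lv k by simp
  fix b b' assume b: "b \<in> Bs" and b': "b' \<in> Bs" "b \<noteq> b'"
  have fb: "finite b" "b \<subseteq> X" "card b = k"
    using bl[OF b] X by (auto intro: finite_subset)
  have v: "1 \<le> v"
    using b finB cB by (metis One_nat_def Suc_leI card_gt_0_iff empty_iff)
  \<comment> \<open>Integers are used because deviations from \<open>l\<close> may be
    negative.\<close>
  let ?O = "Bs - {b}" and ?i = "\<lambda>b'. int (card (b \<inter> b'))"
  have cO: "int (card ?O) = int v - 1"
    using b finB cB v by (simp add: of_nat_diff)
  have lvi: "int l * (int v - 1) = int k * (int k - 1)"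
    using arg_cong[OF lv, of int] k v by (simp add: of_nat_diff)
  have s1: "(\<Sum>b'\<in>?O. ?i b') = int k * (int k - 1)"
  proof -
    have "(\<Sum>b'\<in>?O. card (b \<inter> b')) = (\<Sum>b'\<in>?O. card {x \<in> b. x \<in> b'})"
      by (simp add: Int_def)
    also have "\<dots> = (\<Sum>x\<in>b. card {b' \<in> ?O. x \<in> b'})"
      using finB fb by (intro sum_card_filter_swap) auto
    also have "\<dots> = (\<Sum>x\<in>b. k - 1)"
    proof (rule sum.cong)
      fix x assume x: "x \<in> b"
      have "{b' \<in> ?O. x \<in> b'} = {b' \<in> Bs. x \<in> b'} - {b}"
        by auto
      moreover have "b \<in> {b' \<in> Bs. x \<in> b'}"
        using x b by simp
      ultimately show "card {b' \<in> ?O. x \<in> b'} = k - 1"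
        using r[of x] x fb(2) by (simp only: card_Diff_singleton) auto
    qed simp
    finally have "(\<Sum>b'\<in>?O. card (b \<inter> b')) = k * (k - 1)"
      using fb by simp
    then show ?thesis
      using k by (simp flip: of_nat_sum add: of_nat_diff)
  qed
  \<comment> \<open>Second moment: ordered pairs of distinct points of \<open>b\<close> are counted
    against the other blocks containing both; each pair lies in \<open>l - 1\<close> of
    them.\<close>
  have s2: "(\<Sum>b'\<in>?O. ?i b' * (?i b' - 1)) = int k * (int k - 1) * (int l - 1)"
  proof -
    let ?T = "{(x, y). x \<in> b \<and> y \<in> b \<and> x \<noteq> y}"
    have cT: "int (card {(x, y). x \<in> S \<and> y \<in> S \<and> x \<noteq> y}) = int (card S) * (int (card S) - 1)"
      if "finite S" for S :: "'a set"
    proof -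
      have "{(x, y). x \<in> S \<and> y \<in> S \<and> x \<noteq> y} = (SIGMA x:S. S - {x})"
        by auto
      moreover have "card (SIGMA x:S. S - {x}) = (\<Sum>x\<in>S. card S - 1)"
        using that by (subst card_SigmaI) auto
      ultimately show ?thesis
        using that by (cases "card S") (auto simp: algebra_simps)
    qed
    have finT: "finite ?T"
      by (rule finite_subset[of _ "b \<times> b"]) (use fb in auto)
    have "(\<Sum>b'\<in>?O. ?i b' * (?i b' - 1))
        = int (\<Sum>b'\<in>?O. card {p \<in> ?T. fst p \<in> b' \<and> snd p \<in> b'})"
    proof -
      have "?i b' * (?i b' - 1) = int (card {p \<in> ?T. fst p \<in> b' \<and> snd p \<in> b'})" for b'
      proof -
        have "{p \<in> ?T. fst p \<in> b' \<and> snd p \<in> b'} = {(x, y). x \<in> b \<inter> b' \<and> y \<in> b \<inter> b' \<and> x \<noteq> y}"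
          by auto
        then show ?thesis
          using cT[of "b \<inter> b'"] fb by simp
      qed
      then show ?thesis
        by simp
    qed
    also have "(\<Sum>b'\<in>?O. card {p \<in> ?T. fst p \<in> b' \<and> snd p \<in> b'})
        = (\<Sum>p\<in>?T. card {b' \<in> ?O. fst p \<in> b' \<and> snd p \<in> b'})"
      using finB finT by (intro sum_card_filter_swap) auto
    also have "int \<dots> = (\<Sum>p\<in>?T. int l - 1)"
    proof -
      have "int (card {b' \<in> ?O. fst p \<in> b' \<and> snd p \<in> b'}) = int l - 1" if "p \<in> ?T" for p
      proof -
        have eq: "{b' \<in> ?O. fst p \<in> b' \<and> snd p \<in> b'} = {b' \<in> Bs. fst p \<in> b' \<and> snd p \<in> b'} - {b}"
          by auto
        have m: "b \<in> {b' \<in> Bs. fst p \<in> b' \<and> snd p \<in> b'}"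
          using that b by auto
        have "card {b' \<in> Bs. fst p \<in> b' \<and> snd p \<in> b'} = l"
          using l[of "fst p" "snd p"] that subsetD[OF fb(2)] by auto
        moreover have "0 < card {b' \<in> Bs. fst p \<in> b' \<and> snd p \<in> b'}"
          using m finB by (auto simp: card_gt_0_iff)
        ultimately show ?thesis
          unfolding eq card_Diff_singleton[OF m] by (simp add: of_nat_diff)
      qed
      then show ?thesis
        by simp
    qed
    also have "\<dots> = int k * (int k - 1) * (int l - 1)"
      using cT[OF fb(1)] fb by simp
    finally show ?thesis .
  qed
  have "(\<Sum>b'\<in>?O. (?i b' - int l)\<^sup>2)
      = (\<Sum>b'\<in>?O. ?i b' * (?i b' - 1) + (1 - 2 * int l) * ?i b' + (int l)\<^sup>2)"
    by (rule sum.cong) (auto simp: power2_eq_square algebra_simps)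
  also have "\<dots> = int k * (int k - 1) * (int l - 1) + (1 - 2 * int l) * (int k * (int k - 1))
      + (int v - 1) * (int l)\<^sup>2"
    by (simp only: sum.distrib s2 sum_distrib_left[symmetric] s1) (simp add: cO)
  also have "\<dots> = 0"
    using lvi by algebra
  finally have "(?i b' - int l)\<^sup>2 = 0"
    using finB b' by (subst (asm) sum_nonneg_eq_0_iff) auto
  then show "card (b \<inter> b') = l"
    by simp
qed

section \<open>Counting in a twisted polar space\<close>

text \<open>The main device below: with \<open>h\<close> the trace map \<open>hyp\<close>, a sum
  over points outside \<open>U\<close> becomes a sum over hyperplanes, where only design parameters
  matter.\<close>

lemma sum_const_fibres:
  fixes f :: "'b \<Rightarrow> nat"
  assumes "finite A" "finite S" "h ` A \<subseteq> S" "\<And>s. s \<in> S \<Longrightarrow> card {a \<in> A. h a = s} = c"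
  shows "(\<Sum>a\<in>A. f (h a)) = c * (\<Sum>s\<in>S. f s)"
proof -
  have "(\<Sum>a\<in>A. f (h a)) = (\<Sum>s\<in>S. \<Sum>a | a \<in> A \<and> h a = s. f (h a))"
    using sum.group[OF assms(1-3), of "\<lambda>a. f (h a)"] by simp
  also have "\<dots> = (\<Sum>s\<in>S. c * f s)"
    using assms(4) by (intro sum.cong) simp_all
  finally show ?thesis
    by (simp add: sum_distrib_left)
qed

lemma card_const_fibres:
  assumes "finite A" "finite S" "h ` A \<subseteq> S" "\<And>s. s \<in> S \<Longrightarrow> card {a \<in> A. h a = s} = c"
  shows "card A = c * card S"
  using sum_const_fibres[OF assms, of "\<lambda>_. 1"] by simp

lemma sum_card_related_Un:
  assumes fin: "finite A" "finite D" and disj: "A \<inter> D = {}" and sym: "\<And>z w. r z w \<longleftrightarrow> r w z"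
  shows "(\<Sum>z\<in>A \<union> D. card {w \<in> A \<union> D. r z w}) = (\<Sum>z\<in>A. card {w \<in> A. r z w})
    + 2 * (\<Sum>z\<in>D. card {w \<in> A. r z w}) + (\<Sum>z\<in>D. card {w \<in> D. r z w})"
proof -
  have "card {w \<in> A \<union> D. r z w} = card {w \<in> A. r z w} + card {w \<in> D. r z w}" for z
  proof -
    have "{w \<in> A \<union> D. r z w} = {w \<in> A. r z w} \<union> {w \<in> D. r z w}"
      by auto
    then show ?thesis
      using fin disj by (auto intro: card_Un_disjoint)
  qed
  moreover have "(\<Sum>z\<in>A. card {w \<in> D. r z w}) = (\<Sum>z\<in>D. card {w \<in> A. r w z})"
    by (rule sum_card_filter_swap[OF fin])
  moreover have "r w z \<longleftrightarrow> r z w" for z w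
    by (rule sym)
  ultimately show ?thesis
    by (simp add: sum.union_disjoint[OF fin disj] sum.distrib)
qed

text \<open>In the polar space, with \<open>[m] = (q\<^sup>m - 1) / (q - 1)\<close>, the parameters are \<open>n0 = [d - 2]\<close>,
  \<open>n1 = [d - 1]\<close>, \<open>n2 = [d]\<close> and \<open>e = q\<^bsup>d - 2\<^esup>\<close>; then \<open>m2 = [2 d - 2]\<close> and \<open>m3 = [2 d - 3]\<close>.\<close>

locale twisted_polar_space =
  fixes P U :: "'a set" and ort :: "'a \<Rightarrow> 'a \<Rightarrow> bool" and \<H> :: "'a set set"
    and \<phi> :: "'a set \<Rightarrow> 'a set" and hyp :: "'a \<Rightarrow> 'a set" and Q :: "'a set"
    and q n0 n1 n2 e m2 m3 :: nat
  defines "hyp \<equiv> \<lambda>z. {u \<in> U. ort z u}" and "Q \<equiv> P - U"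
    and "m2 \<equiv> n1 + q * e * n1" and "m3 \<equiv> n1 + q * e * n0"
  assumes finite_P: "finite P" and U_sub: "U \<subseteq> P"
    and q_pos: "0 < q" and e_pos: "0 < e"
    and n1_eq: "n1 = n0 + e" "n1 = q * n0 + 1" and n2_eq: "n2 = n1 + q * e"
    and ort_sym: "ort x y \<longleftrightarrow> ort y x"
    and ort_refl: "x \<in> P \<Longrightarrow> ort x x"
    and ort_U: "x \<in> U \<Longrightarrow> y \<in> U \<Longrightarrow> ort x y"
    and card_U: "card U = n2"
    and card_\<H>: "card \<H> = n2"
    and \<H>_sub: "H \<in> \<H> \<Longrightarrow> H \<subseteq> U"
    and \<phi>_sub: "H \<in> \<H> \<Longrightarrow> \<phi> H \<subseteq> U"
    and card_\<phi>: "H \<in> \<H> \<Longrightarrow> card (\<phi> H) = n1"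
    and card_\<phi>_Int: "H \<in> \<H> \<Longrightarrow> H' \<in> \<H> \<Longrightarrow> H \<noteq> H' \<Longrightarrow> card (\<phi> H \<inter> \<phi> H') = n0"
    and \<phi>_through1: "x \<in> U \<Longrightarrow> card {H \<in> \<H>. x \<in> \<phi> H} = n1"
    and \<phi>_through2: "x \<in> U \<Longrightarrow> y \<in> U \<Longrightarrow> x \<noteq> y \<Longrightarrow> card {H \<in> \<H>. x \<in> \<phi> H \<and> y \<in> \<phi> H} = n0"
    and hyp_in: "z \<in> Q \<Longrightarrow> hyp z \<in> \<H>"
    and card_hyp: "z \<in> Q \<Longrightarrow> card (hyp z) = n1"
    and card_hyp_Int: "y \<in> Q \<Longrightarrow> z \<in> Q \<Longrightarrow> hyp y \<noteq> hyp z \<Longrightarrow> card (hyp y \<inter> hyp z) = n0"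
    and fibre0: "H \<in> \<H> \<Longrightarrow> card {z \<in> Q. hyp z = H} = q * q * e"
    and fibre1: "H \<in> \<H> \<Longrightarrow> y \<in> Q \<Longrightarrow> card {z \<in> Q. ort y z \<and> hyp z = H} = q * e"
    and fibre2: "H \<in> \<H> \<Longrightarrow> y \<in> Q \<Longrightarrow> z \<in> Q \<Longrightarrow> hyp y \<noteq> hyp z \<Longrightarrow>
      card {w \<in> Q. ort y w \<and> ort z w \<and> hyp w = H} = e"
    and ort_trans: "y \<in> Q \<Longrightarrow> z \<in> Q \<Longrightarrow> w \<in> Q \<Longrightarrow> hyp y = hyp z \<Longrightarrow> hyp y = hyp w \<Longrightarrow>
      ort y z \<Longrightarrow> ort y w \<Longrightarrow> ort z w"
    and card_ort2: "x \<in> P \<Longrightarrow> y \<in> P \<Longrightarrow> x \<noteq> y \<Longrightarrow> card {z \<in> P. ort x z \<and> ort y z} = m2"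
    and ort_pairs: "x \<in> P \<Longrightarrow> y \<in> P \<Longrightarrow> x \<noteq> y \<Longrightarrow>
      (\<Sum>z | z \<in> P \<and> ort x z \<and> ort y z. card {w \<in> P. ort x w \<and> ort y w \<and> ort z w})
        = m2 * m3 + of_bool (ort x y) * ((q + 1) * (q * e * e))"
begin

text \<open>Adjacency with a loop at every point of \<open>P\<close>; a point outside
  \<open>U\<close> still reaches \<open>U\<close> only through the twisted hyperplane.\<close>

definition adj :: "'a \<Rightarrow> 'a \<Rightarrow> bool" where
  "adj x y \<longleftrightarrow> (if x \<in> U then if y \<in> U then True else x \<in> \<phi> (hyp y)
     else if y \<in> U then y \<in> \<phi> (hyp x) else ort x y)"

lemma adj_simps:
  "x \<in> U \<Longrightarrow> y \<in> U \<Longrightarrow> adj x y"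
  "x \<in> U \<Longrightarrow> y \<in> Q \<Longrightarrow> adj x y \<longleftrightarrow> x \<in> \<phi> (hyp y)"
  "x \<in> Q \<Longrightarrow> y \<in> U \<Longrightarrow> adj x y \<longleftrightarrow> y \<in> \<phi> (hyp x)"
  "x \<in> Q \<Longrightarrow> y \<in> Q \<Longrightarrow> adj x y \<longleftrightarrow> ort x y"
  by (auto simp: adj_def Q_def)

lemma adj_sym: "adj x y \<longleftrightarrow> adj y x"
  using ort_sym by (auto simp: adj_def)

lemma adj_refl: "x \<in> P \<Longrightarrow> adj x x"
  using ort_refl by (simp add: adj_def)

lemma finite_U [simp]: "finite U"
  and finite_Q [simp]: "finite Q"
  using finite_P U_sub finite_subset unfolding Q_def by auto

lemma finite_\<H> [simp]: "finite \<H>"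
  by (rule finite_subset[of _ "Pow U"]) (use \<H>_sub in auto)

lemma mem_hyp: "u \<in> hyp z \<longleftrightarrow> u \<in> U \<and> ort z u"
  by (simp add: hyp_def)

lemma P_eq: "P = U \<union> Q" "U \<inter> Q = {}"
  using U_sub by (auto simp: Q_def)

lemma card_split: "card {z \<in> P. p z} = card {z \<in> U. p z} + card {z \<in> Q. p z}"
proof -
  have "{z \<in> P. p z} = {z \<in> U. p z} \<union> {z \<in> Q. p z}"
    using P_eq by auto
  then show ?thesis
    using P_eq by (auto intro: card_Un_disjoint)
qed

text \<open>Writing \<open>q = p + 1\<close>, all parameters are polynomials in \<open>p\<close> and \<open>n0\<close>.\<close>

lemma parameters:
  obtains p where "q = Suc p" "e = p * n0 + 1" "n1 = Suc p * n0 + 1" "n2 = Suc p * (Suc p * n0 + 1) + 1"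
proof -
  obtain p where p: "q = Suc p"
    using q_pos by (cases q) auto
  moreover from p have "e = p * n0 + 1"
    using n1_eq by simp
  ultimately show ?thesis
    using that n1_eq n2_eq by (simp add: algebra_simps)
qed

section \<open>Common neighbours and the adjacent pairs among them\<close>

definition common :: "'a \<Rightarrow> 'a \<Rightarrow> 'a set" where
  "common x y = {z \<in> P. adj x z \<and> adj y z}"

text \<open>The pairs are ordered and, because of the loops, include those with
  \<open>z = w\<close>; \<open>x\<close> and \<open>y\<close> themselves take part when they are
  adjacent.\<close>

definition pairs :: "'a \<Rightarrow> 'a \<Rightarrow> nat" where
  "pairs x y = (\<Sum>z\<in>common x y. card {w \<in> common x y. adj z w})"

lemma mem_common: "z \<in> common x y \<longleftrightarrow> (z \<in> U \<or> z \<in> Q) \<and> adj x z \<and> adj y z"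
  unfolding common_def using P_eq by blast

lemma common_sym: "common x y = common y x"
  by (auto simp: common_def)

lemma pairs_sym: "pairs x y = pairs y x"
  by (simp add: pairs_def common_sym)

lemma card_\<phi>_through_sum:
  assumes "S \<subseteq> U"
  shows "(\<Sum>H\<in>\<H>. card (S \<inter> \<phi> H)) = card S * n1"
proof -
  have fS: "finite S"
    using assms finite_U finite_subset by blast
  have "(\<Sum>H\<in>\<H>. card (S \<inter> \<phi> H)) = (\<Sum>H\<in>\<H>. card {x \<in> S. x \<in> \<phi> H})"
    by (simp add: Int_def)
  also have "\<dots> = (\<Sum>x\<in>S. card {H \<in> \<H>. x \<in> \<phi> H})"
    using fS by (intro sum_card_filter_swap) auto
  also have "\<dots> = (\<Sum>x\<in>S. n1)"
    using assms by (intro sum.cong) (auto simp: \<phi>_through1)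
  finally show ?thesis
    by simp
qed

text \<open>A point of \<open>U\<close> sees all of \<open>U\<close> and the full fibres over
  \<open>n1\<close> hyperplanes; a point outside sees \<open>n1\<close> points of \<open>U\<close>
  and \<open>q * e\<close> points over each of the \<open>n2\<close> hyperplanes. The two totals
  agree as polynomials in the parameters.\<close>

lemma degree: assumes "x \<in> P" shows "card {z \<in> P. adj x z} = n2 + q * q * e * n1"
proof (cases "x \<in> U")
  case True
  have "{z \<in> U. adj x z} = U"
    using True by (auto simp: adj_simps)
  moreover have "card {z \<in> Q. adj x z} = q * q * e * card {H \<in> \<H>. x \<in> \<phi> H}"
  proof (rule card_const_fibres[where h = hyp])
    show "hyp ` {z \<in> Q. adj x z} \<subseteq> {H \<in> \<H>. x \<in> \<phi> H}"
      using True by (auto simp: adj_simps hyp_in)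
    fix H assume "H \<in> {H \<in> \<H>. x \<in> \<phi> H}"
    moreover from this have "{z \<in> {z \<in> Q. adj x z}. hyp z = H} = {z \<in> Q. hyp z = H}"
      using True by (auto simp: adj_simps)
    ultimately show "card {z \<in> {z \<in> Q. adj x z}. hyp z = H} = q * q * e"
      by (simp add: fibre0)
  qed auto
  ultimately show ?thesis
    using True by (simp add: card_split card_U \<phi>_through1)
next
  case False
  then have x: "x \<in> Q"
    using assms by (simp add: Q_def)
  have "{z \<in> U. adj x z} = \<phi> (hyp x)"
    using x \<phi>_sub[OF hyp_in[OF x]] by (auto simp: adj_simps)
  moreover have "{z \<in> Q. adj x z} = {z \<in> Q. ort x z}"
    using x by (auto simp: adj_simps)
  moreover have "card {z \<in> Q. ort x z} = q * e * card \<H>"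
    by (rule card_const_fibres[where h = hyp]) (use x fibre1 hyp_in in \<open>auto simp: conj_assoc\<close>)
  ultimately have "card {z \<in> P. adj x z} = n1 + q * e * n2"
    using x by (simp add: card_split card_\<phi> hyp_in card_\<H>)
  also have "\<dots> = n2 + q * q * e * n1"
    by (rule parameters) (simp add: algebra_simps)
  finally show ?thesis .
qed

lemma pairs_split:
  assumes M: "common x y = MU \<union> MQ" and MU: "MU \<subseteq> U" and MQ: "MQ \<subseteq> Q"
  shows "pairs x y = card MU * card MU + 2 * (\<Sum>w\<in>MQ. card (MU \<inter> \<phi> (hyp w)))
    + (\<Sum>z\<in>MQ. card {w \<in> MQ. ort z w})"
proof -
  have fin: "finite MU" "finite MQ"
    using MU MQ finite_U finite_Q finite_subset by blast+
  have disj: "MU \<inter> MQ = {}"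
    using MU MQ P_eq by blast
  have "pairs x y = (\<Sum>z\<in>MU. card {w \<in> MU. adj z w})
      + 2 * (\<Sum>z\<in>MQ. card {w \<in> MU. adj z w}) + (\<Sum>z\<in>MQ. card {w \<in> MQ. adj z w})"
    unfolding pairs_def M by (rule sum_card_related_Un[OF fin disj adj_sym])
  moreover have "(\<Sum>z\<in>MU. card {w \<in> MU. adj z w}) = card MU * card MU"
  proof -
    have "{w \<in> MU. adj z w} = MU" if "z \<in> MU" for z
      using that MU by (auto simp: adj_simps subset_iff)
    then show ?thesis
      by simp
  qed
  moreover have "(\<Sum>z\<in>MQ. card {w \<in> MU. adj z w}) = (\<Sum>w\<in>MQ. card (MU \<inter> \<phi> (hyp w)))"
  proof (rule sum.cong[OF refl])
    fix z assume "z \<in> MQ"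
    then have "{w \<in> MU. adj z w} = MU \<inter> \<phi> (hyp z)"
      using MU MQ by (auto simp: adj_simps subset_iff)
    then show "card {w \<in> MU. adj z w} = card (MU \<inter> \<phi> (hyp z))"
      by simp
  qed
  moreover have "(\<Sum>z\<in>MQ. card {w \<in> MQ. adj z w}) = (\<Sum>z\<in>MQ. card {w \<in> MQ. ort z w})"
  proof (rule sum.cong[OF refl])
    fix z assume "z \<in> MQ"
    then have "{w \<in> MQ. adj z w} = {w \<in> MQ. ort z w}"
      using MQ by (auto simp: adj_simps subset_iff)
    then show "card {w \<in> MQ. adj z w} = card {w \<in> MQ. ort z w}"
      by simp
  qed
  ultimately show ?thesis
    by simp
qed

text \<open>The outer common neighbours are the full fibres over the \<open>n0\<close> hyperplanes
  whose images contain both points. Two points of \<open>U\<close> are always adjacent, so the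
  excess term is unconditional.\<close>

lemma both_in_U:
  assumes x: "x \<in> U" and y: "y \<in> U" and xy: "x \<noteq> y"
  shows "card (common x y) = m2" and "pairs x y = m2 * m3 + (q + 1) * (q * e * e)"
proof -
  let ?S = "{H \<in> \<H>. x \<in> \<phi> H \<and> y \<in> \<phi> H}"
  define MQ where "MQ = {z \<in> Q. hyp z \<in> ?S}"
  have M: "common x y = U \<union> MQ"
    using x y hyp_in by (auto simp: mem_common MQ_def adj_simps)
  have fib: "card {z \<in> MQ. hyp z = H} = q * q * e" if "H \<in> ?S" for H
  proof -
    have "{z \<in> MQ. hyp z = H} = {z \<in> Q. hyp z = H}"
      using that by (auto simp: MQ_def)
    then show ?thesis
      using that by (simp add: fibre0)
  qed
  have sub: "MQ \<subseteq> Q" and finMQ: "finite MQ" and img: "hyp ` MQ \<subseteq> ?S"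
    by (auto simp: MQ_def)
  have cS: "card ?S = n0"
    using \<phi>_through2[OF x y xy] .
  have cMQ: "card MQ = q * q * e * n0"
    using card_const_fibres[OF finMQ _ img fib] cS by simp
  have "card (common x y) = n2 + q * q * e * n0"
    unfolding M using cMQ sub P_eq(2) finMQ by (subst card_Un_disjoint) (auto simp: card_U)
  also have "\<dots> = m2"
    unfolding m2_def by (rule parameters) (simp add: algebra_simps)
  finally show "card (common x y) = m2" .
  have s2: "(\<Sum>w\<in>MQ. card (U \<inter> \<phi> (hyp w))) = card MQ * n1"
  proof -
    have "card (U \<inter> \<phi> (hyp w)) = n1" if "w \<in> MQ" for w
      using that \<phi>_sub card_\<phi> by (auto simp: MQ_def Int_absorb1)
    then show ?thesis
      by simp
  qed
  \<comment> \<open>\<open>fibre1\<close> also covers the hyperplane of \<open>z\<close> itself, so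
    all rows have equal size.\<close>
  have s3: "(\<Sum>z\<in>MQ. card {w \<in> MQ. ort z w}) = card MQ * (q * e * n0)"
  proof -
    have "card {w \<in> MQ. ort z w} = q * e * card ?S" if "z \<in> MQ" for z
    proof (rule card_const_fibres[where h = hyp])
      fix H assume H: "H \<in> ?S"
      have "{w \<in> {w \<in> MQ. ort z w}. hyp w = H} = {w \<in> Q. ort z w \<and> hyp w = H}"
        using H by (auto simp: MQ_def)
      then show "card {w \<in> {w \<in> MQ. ort z w}. hyp w = H} = q * e"
        using fibre1[of H z] H that by (simp add: MQ_def)
    qed (use finMQ img in auto)
    then show ?thesis
      using cS by simp
  qed
  have "pairs x y = n2 * n2 + 2 * (q * q * e * n0 * n1) + q * q * e * n0 * (q * e * n0)"
    unfolding pairs_split[OF M subset_refl sub] s2 s3 cMQ card_U ..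
  also have "\<dots> = m2 * m3 + (q + 1) * (q * e * e)"
    unfolding m2_def m3_def by (rule parameters) (simp add: algebra_simps)
  finally show "pairs x y = m2 * m3 + (q + 1) * (q * e * e)" .
qed

text \<open>Here \<open>x\<close> and \<open>y\<close> are adjacent exactly when the hyperplane
  \<open>?K\<close> of \<open>y\<close> belongs to \<open>?S\<close>. If not, every intersection has
  size \<open>n0\<close> and \<open>fibre2\<close> applies throughout. If so, \<open>?K\<close> is
  the exceptional hyperplane and its fibre is treated separately.\<close>

lemma one_in_U:
  assumes x: "x \<in> U" and y: "y \<in> Q"
  shows "card (common x y) = m2"
    and "pairs x y = m2 * m3 + of_bool (adj x y) * ((q + 1) * (q * e * e))"
proof -
  let ?K = "hyp y" and ?S = "{H \<in> \<H>. x \<in> \<phi> H}"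
  define MQ where "MQ = {z \<in> Q. ort y z \<and> hyp z \<in> ?S}"
  have K: "?K \<in> \<H>"
    using hyp_in[OF y] .
  have M: "common x y = \<phi> ?K \<union> MQ"
    using x y hyp_in \<phi>_sub[OF K] by (auto simp: mem_common MQ_def adj_simps)
  have fib: "card {z \<in> MQ. hyp z = H} = q * e" if "H \<in> ?S" for H
  proof -
    have "{z \<in> MQ. hyp z = H} = {z \<in> Q. ort y z \<and> hyp z = H}"
      using that by (auto simp: MQ_def)
    then show ?thesis
      using that by (simp add: fibre1 y)
  qed
  have sub: "MQ \<subseteq> Q" and finMQ: "finite MQ" and img: "hyp ` MQ \<subseteq> ?S" and finS: "finite ?S"
    by (auto simp: MQ_def)
  have cS: "card ?S = n1"
    using \<phi>_through1[OF x] .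
  have cMQ: "card MQ = q * e * n1"
    using card_const_fibres[OF finMQ finS img fib] cS by simp
  have finK: "finite (\<phi> ?K)"
    using \<phi>_sub[OF K] finite_U finite_subset by blast
  show "card (common x y) = m2"
    unfolding M m2_def using cMQ sub P_eq(2) finMQ finK \<phi>_sub[OF K]
    by (subst card_Un_disjoint) (auto simp: card_\<phi>[OF K])
  have s2: "(\<Sum>w\<in>MQ. card (\<phi> ?K \<inter> \<phi> (hyp w))) = q * e * (\<Sum>H\<in>?S. card (\<phi> ?K \<inter> \<phi> H))"
    by (rule sum_const_fibres[OF finMQ finS img fib])
  have ps: "pairs x y = n1 * n1 + 2 * (q * e * (\<Sum>H\<in>?S. card (\<phi> ?K \<inter> \<phi> H)))
      + (\<Sum>z\<in>MQ. card {w \<in> MQ. ort z w})"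
    unfolding pairs_split[OF M \<phi>_sub[OF K] sub] s2 card_\<phi>[OF K] ..
  \<comment> \<open>Off the fibre of \<open>?K\<close> the points \<open>y\<close> and
    \<open>z\<close> have distinct traces, so each hyperplane of \<open>T\<close> contributes
    \<open>e\<close> points by \<open>fibre2\<close>.\<close>
  have other: "card {w \<in> MQ. ort z w \<and> hyp w \<in> T} = e * card T"
    if "z \<in> MQ" "hyp z \<noteq> ?K" "T \<subseteq> ?S" for z T
  proof (rule card_const_fibres[where h = hyp])
    fix H assume H: "H \<in> T"
    have "{w \<in> {w \<in> MQ. ort z w \<and> hyp w \<in> T}. hyp w = H} = {w \<in> Q. ort y w \<and> ort z w \<and> hyp w = H}"
      using H that(3) by (auto simp: MQ_def)
    then show "card {w \<in> {w \<in> MQ. ort z w \<and> hyp w \<in> T}. hyp w = H} = e"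
      using fibre2[of H y z] H that y by (auto simp: MQ_def)
  qed (use finMQ finite_subset[OF that(3) finS] in auto)
  show "pairs x y = m2 * m3 + of_bool (adj x y) * ((q + 1) * (q * e * e))"
  proof (cases "adj x y")
    case False
    then have KS: "?K \<notin> ?S"
      using x y by (simp add: adj_simps)
    have "(\<Sum>H\<in>?S. card (\<phi> ?K \<inter> \<phi> H)) = (\<Sum>H\<in>?S. n0)"
      using KS K by (intro sum.cong) (auto intro!: card_\<phi>_Int)
    moreover have "(\<Sum>z\<in>MQ. card {w \<in> MQ. ort z w}) = (\<Sum>z\<in>MQ. e * n1)"
    proof (rule sum.cong[OF refl])
      fix z assume z: "z \<in> MQ"
      then have "hyp z \<noteq> ?K"
        using KS by (auto simp: MQ_def)
      moreover have "{w \<in> MQ. ort z w \<and> hyp w \<in> ?S} = {w \<in> MQ. ort z w}"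
        using img by auto
      ultimately show "card {w \<in> MQ. ort z w} = e * n1"
        using other[OF z, of ?S] cS by simp
    qed
    ultimately have "pairs x y = n1 * n1 + 2 * (q * e * (n1 * n0)) + q * e * n1 * (e * n1)"
      using ps cS cMQ by simp
    also have "\<dots> = m2 * m3"
      unfolding m2_def m3_def by (rule parameters) (simp add: algebra_simps)
    finally show ?thesis
      using False by simp
  next
    case True
    then have KS: "?K \<in> ?S"
      using x y K by (simp add: adj_simps)
    let ?T = "?S - {?K}"
    \<comment> \<open>From \<open>n1 = q * n0 + 1\<close>, the one being \<open>?K\<close>.\<close>
    have cT: "card ?T = q * n0"
      using KS cS finS n1_eq(2) by simp
    have sumS: "(\<Sum>H\<in>?S. card (\<phi> ?K \<inter> \<phi> H)) = n1 + q * n0 * n0"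
    proof -
      have "(\<Sum>H\<in>?T. card (\<phi> ?K \<inter> \<phi> H)) = (\<Sum>H\<in>?T. n0)"
        using K by (intro sum.cong) (auto intro!: card_\<phi>_Int)
      then show ?thesis
        using sum.remove[OF finS KS, of "\<lambda>H. card (\<phi> ?K \<inter> \<phi> H)"] cT by (simp add: card_\<phi>[OF K])
    qed
    define A where "A = {z \<in> MQ. hyp z = ?K}"
    define D where "D = {z \<in> MQ. hyp z \<in> ?T}"
    have AD: "MQ = A \<union> D" "A \<inter> D = {}" "finite A" "finite D"
      using img finMQ by (auto simp: A_def D_def)
    have cA: "card A = q * e"
      unfolding A_def by (rule fib[OF KS])
    have cD: "card D = q * e * (q * n0)"
    proof -
      have "card D = q * e * card ?T"
      proof (rule card_const_fibres[where h = hyp])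
        fix H assume H: "H \<in> ?T"
        then have "{z \<in> D. hyp z = H} = {z \<in> MQ. hyp z = H}"
          by (auto simp: D_def)
        then show "card {z \<in> D. hyp z = H} = q * e"
          using fib[of H] H by simp
      qed (use AD finS in \<open>auto simp: D_def\<close>)
      then show ?thesis
        using cT by simp
    qed
    \<comment> \<open>All points of \<open>A\<close> have the trace of \<open>y\<close> and are
      orthogonal to \<open>y\<close>, so \<open>ort_trans\<close> makes them mutually orthogonal;
      this is what distinguishes the exceptional fibre.\<close>
    have AA: "{w \<in> A. ort z w} = A" if "z \<in> A" for z
      using that ort_trans[OF y] y by (auto simp: A_def MQ_def)
    have DA: "card {w \<in> A. ort z w} = e" if "z \<in> D" for z
    proof -
      have "{w \<in> A. ort z w} = {w \<in> MQ. ort z w \<and> hyp w \<in> {?K}}"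
        by (auto simp: A_def)
      then show ?thesis
        using other[of z "{?K}"] that KS by (auto simp: D_def)
    qed
    have DD: "card {w \<in> D. ort z w} = e * (q * n0)" if "z \<in> D" for z
    proof -
      have "{w \<in> D. ort z w} = {w \<in> MQ. ort z w \<and> hyp w \<in> ?T}"
        by (auto simp: D_def)
      then show ?thesis
        using other[of z "?T"] that cT by (auto simp: D_def)
    qed
    have "(\<Sum>z\<in>MQ. card {w \<in> MQ. ort z w})
        = q * e * (q * e) + 2 * (q * e * (q * n0) * e) + q * e * (q * n0) * (e * (q * n0))"
      unfolding AD(1) using sum_card_related_Un[OF AD(3,4,2) ort_sym] by (simp add: AA DA DD cA cD)
    then have "pairs x y = n1 * n1 + 2 * (q * e * (n1 + q * n0 * n0)) +
        (q * e * (q * e) + 2 * (q * e * (q * n0) * e) + q * e * (q * n0) * (e * (q * n0)))"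
      using ps sumS by simp
    also have "\<dots> = m2 * m3 + (q + 1) * (q * e * e)"
      unfolding m2_def m3_def by (rule parameters) (simp add: algebra_simps)
    finally show ?thesis
      using True by simp
  qed
qed

text \<open>The number is recovered from \<open>card_ort2\<close>: the common perp of
  \<open>p\<close> and an outer point \<open>x\<close> has \<open>n1\<close> points in
  \<open>U\<close> and \<open>q * e\<close> over each hyperplane through \<open>p\<close>.\<close>

lemma hyperplanes_through:
  assumes x: "x \<in> Q" and p: "p \<in> U"
  shows "card {H \<in> \<H>. p \<in> H} = n1"
proof -
  have "card {z \<in> P. ort x z \<and> ort p z} = m2"
    using card_ort2[of x p] x p P_eq by auto
  moreover have "card {z \<in> U. ort x z \<and> ort p z} = n1"
  proof -
    have "{z \<in> U. ort x z \<and> ort p z} = hyp x"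
      using p ort_U by (auto simp: mem_hyp)
    then show ?thesis
      using card_hyp[OF x] by simp
  qed
  moreover have "card {z \<in> Q. ort x z \<and> ort p z} = q * e * card {H \<in> \<H>. p \<in> H}"
  proof (rule card_const_fibres[where h = hyp])
    show "hyp ` {z \<in> Q. ort x z \<and> ort p z} \<subseteq> {H \<in> \<H>. p \<in> H}"
      using p hyp_in ort_sym by (auto simp: mem_hyp)
    fix H assume H: "H \<in> {H \<in> \<H>. p \<in> H}"
    then have "{z \<in> {z \<in> Q. ort x z \<and> ort p z}. hyp z = H} = {z \<in> Q. ort x z \<and> hyp z = H}"
      using ort_sym by (auto simp: mem_hyp)
    then show "card {z \<in> {z \<in> Q. ort x z \<and> ort p z}. hyp z = H} = q * e"
      using H x by (simp add: fibre1)
  qed auto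
  ultimately show ?thesis
    using card_split[of "\<lambda>z. ort x z \<and> ort p z"] q_pos e_pos by (simp add: m2_def)
qed

lemma card_\<phi>_Int_eq:
  assumes "x \<in> Q" "y \<in> Q"
  shows "card (\<phi> (hyp x) \<inter> \<phi> (hyp y)) = card (hyp x \<inter> hyp y)"
proof (cases "hyp x = hyp y")
  case True
  then show ?thesis
    using card_\<phi>[OF hyp_in[OF assms(2)]] card_hyp[OF assms(2)] by simp
next
  case False
  then show ?thesis
    using card_\<phi>_Int[OF hyp_in[OF assms(1)] hyp_in[OF assms(2)]] card_hyp_Int[OF assms] by simp
qed

text \<open>The outer common neighbours are untwisted, and the part in \<open>U\<close> is replaced
  by a set of the same size. Once the cross terms are shown to agree, \<open>ort_pairs\<close> gives
  the count.\<close>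

lemma none_in_U:
  assumes x: "x \<in> Q" and y: "y \<in> Q" and xy: "x \<noteq> y"
  shows "card (common x y) = m2"
    and "pairs x y = m2 * m3 + of_bool (adj x y) * ((q + 1) * (q * e * e))"
proof -
  let ?MU = "\<phi> (hyp x) \<inter> \<phi> (hyp y)" and ?A = "hyp x \<inter> hyp y"
  define MQ where "MQ = {z \<in> Q. ort x z \<and> ort y z}"
  note Hx = hyp_in[OF x] and Hy = hyp_in[OF y]
  have M: "common x y = ?MU \<union> MQ"
    using x y \<phi>_sub[OF Hx] by (auto simp: mem_common MQ_def adj_simps)
  have MU: "?MU \<subseteq> U" and sub: "MQ \<subseteq> Q" and finMQ: "finite MQ" and finA: "finite ?A"
    using \<phi>_sub[OF Hx] by (auto simp: MQ_def hyp_def)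
  have finMU: "finite ?MU"
    by (rule finite_subset[OF MU finite_U])
  have cMU: "card ?MU = card ?A"
    by (rule card_\<phi>_Int_eq[OF x y])
  have A: "?A = {z \<in> U. ort x z \<and> ort y z}"
    by (auto simp: hyp_def)
  have P': "{z \<in> P. ort x z \<and> ort y z} = ?A \<union> MQ" "?A \<inter> MQ = {}"
    using P_eq by (auto simp: MQ_def A)
  have "m2 = card ?A + card MQ"
    using card_ort2[of x y] x y xy P_eq finA finMQ unfolding P'(1) by (simp add: card_Un_disjoint P')
  then show "card (common x y) = m2"
    unfolding M cMU[symmetric] using finMU finMQ MU sub P_eq(2)
    by (subst card_Un_disjoint) auto
  \<comment> \<open>For equal traces the summands agree one by one. For distinct traces
    \<open>MQ\<close> has \<open>e\<close> points over every hyperplane, and both sums reduce to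
    incidence counts in which each point lies on \<open>n1\<close> members.\<close>
  have s2: "(\<Sum>w\<in>MQ. card (?MU \<inter> \<phi> (hyp w))) = (\<Sum>w\<in>MQ. card (?A \<inter> hyp w))"
  proof (cases "hyp x = hyp y")
    case True
    have "card (\<phi> (hyp x) \<inter> \<phi> (hyp w)) = card (hyp x \<inter> hyp w)" if "w \<in> MQ" for w
      using that sub by (intro card_\<phi>_Int_eq[OF x]) auto
    then show ?thesis
      using True by simp
  next
    case False
    have fib: "card {w \<in> MQ. hyp w = H} = e" if "H \<in> \<H>" for H
      using fibre2[OF that x y False] by (simp add: MQ_def conj_assoc)
    have img: "hyp ` MQ \<subseteq> \<H>"
      using sub hyp_in by auto
    have "(\<Sum>w\<in>MQ. card (?MU \<inter> \<phi> (hyp w))) = e * (card ?MU * n1)"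
      using sum_const_fibres[OF finMQ finite_\<H> img fib, of "\<lambda>H. card (?MU \<inter> \<phi> H)"]
      by (simp add: card_\<phi>_through_sum[OF MU])
    moreover have "(\<Sum>w\<in>MQ. card (?A \<inter> hyp w)) = e * (\<Sum>H\<in>\<H>. card (?A \<inter> H))"
      using sum_const_fibres[OF finMQ finite_\<H> img fib, of "\<lambda>H. card (?A \<inter> H)"] .
    moreover have "(\<Sum>H\<in>\<H>. card (?A \<inter> H)) = card ?A * n1"
    proof -
      have "(\<Sum>H\<in>\<H>. card (?A \<inter> H)) = (\<Sum>H\<in>\<H>. card {p \<in> ?A. p \<in> H})"
        by (simp add: Int_def)
      also have "\<dots> = (\<Sum>p\<in>?A. card {H \<in> \<H>. p \<in> H})"
        using finA by (intro sum_card_filter_swap) auto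
      also have "\<dots> = (\<Sum>p\<in>?A. n1)"
        by (rule sum.cong) (auto simp: A hyperplanes_through[OF x])
      finally show ?thesis
        by simp
    qed
    ultimately show ?thesis
      using cMU by simp
  qed
  show "pairs x y = m2 * m3 + of_bool (adj x y) * ((q + 1) * (q * e * e))"
  proof -
    have "pairs x y = card ?A * card ?A + 2 * (\<Sum>w\<in>MQ. card (?A \<inter> hyp w))
        + (\<Sum>z\<in>MQ. card {w \<in> MQ. ort z w})"
      unfolding pairs_split[OF M MU sub] cMU s2 ..
    \<comment> \<open>The same splitting as in \<open>pairs_split\<close>, now read backwards for
      the untwisted relation \<open>ort\<close>.\<close>
    also have "\<dots> = (\<Sum>z\<in>?A \<union> MQ. card {w \<in> ?A \<union> MQ. ort z w})"
    proof -
      have "(\<Sum>z\<in>?A. card {w \<in> ?A. ort z w}) = card ?A * card ?A"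
      proof -
        have "{w \<in> ?A. ort z w} = ?A" if "z \<in> ?A" for z
          using that ort_U by (auto simp: mem_hyp)
        then show ?thesis
          by simp
      qed
      moreover have "(\<Sum>z\<in>MQ. card {w \<in> ?A. ort z w}) = (\<Sum>z\<in>MQ. card (?A \<inter> hyp z))"
      proof (rule sum.cong[OF refl])
        fix z
        have "{w \<in> ?A. ort z w} = ?A \<inter> hyp z"
          by (auto simp: mem_hyp)
        then show "card {w \<in> ?A. ort z w} = card (?A \<inter> hyp z)"
          by simp
      qed
      ultimately show ?thesis
        using sum_card_related_Un[OF finA finMQ P'(2) ort_sym] by simp
    qed
    also have "\<dots> = (\<Sum>z | z \<in> P \<and> ort x z \<and> ort y z. card {w \<in> P. ort x w \<and> ort y w \<and> ort z w})"
      unfolding P'(1)[symmetric] by (simp add: conj_assoc)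
    also have "\<dots> = m2 * m3 + of_bool (adj x y) * ((q + 1) * (q * e * e))"
      using ort_pairs[of x y] x y xy P_eq by (auto simp: adj_simps)
    finally show ?thesis .
  qed
qed

lemma card_common:
  assumes "x \<in> P" "y \<in> P" "x \<noteq> y"
  shows "card (common x y) = m2"
    and "pairs x y = m2 * m3 + of_bool (adj x y) * ((q + 1) * (q * e * e))"
proof -
  consider "x \<in> U" "y \<in> U" | "x \<in> U" "y \<in> Q" | "y \<in> U" "x \<in> Q" | "x \<in> Q" "y \<in> Q"
    using assms P_eq by blast
  then have "card (common x y) = m2 \<and>
      pairs x y = m2 * m3 + of_bool (adj x y) * ((q + 1) * (q * e * e))"
  proof cases
    case 1
    then show ?thesis
      using both_in_U assms(3) by (simp add: adj_simps)
  next
    case 2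
    then show ?thesis
      using one_in_U by simp
  next
    case 3
    then show ?thesis
      using one_in_U[of y x] by (simp add: adj_sym[of x] common_sym[of x] pairs_sym[of x])
  next
    case 4
    then show ?thesis
      using none_in_U assms(3) by simp
  qed
  then show "card (common x y) = m2"
    and "pairs x y = m2 * m3 + of_bool (adj x y) * ((q + 1) * (q * e * e))"
    by auto
qed

end

section \<open>Removing the loops\<close>

context twisted_polar_space begin

lemma four_vertex_condition_adj:
  assumes E: "\<And>x y. E x y \<longleftrightarrow> x \<in> P \<and> y \<in> P \<and> x \<noteq> y \<and> adj x y"
  shows "vertex_condition 4 P E"
proof -
  have Es: "E x y \<longleftrightarrow> E y x" for x y
    using adj_sym[of x y] by (auto simp: E)
  have loops: "common x y = {z. E x z \<and> E y z} \<union> (if E x y then {x, y} else {})"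
    "{z. E x z \<and> E y z} \<inter> (if E x y then {x, y} else {}) = {}" if "x \<in> P" "y \<in> P" "x \<noteq> y" for x y
    using that adj_refl adj_sym[of x y] by (auto simp: common_def E)
  have fin: "finite {z. E x z \<and> p z}" "finite (common x y)" for x y p
    using finite_P by (auto simp: E common_def)
  have finite_E: "finite {z. E x z}" for x
    using finite_P by (auto simp: E)
  have cC: "card {z. E x z \<and> E y z} + 2 * of_bool (E x y) = m2"
    if "x \<in> P" "y \<in> P" "x \<noteq> y" for x y
  proof -
    have "card (common x y) = card {z. E x z \<and> E y z} + card (if E x y then {x, y} else {})"
      unfolding loops(1)[OF that] by (rule card_Un_disjoint[OF _ _ loops(2)[OF that]]) (auto simp: fin)
    then show ?thesis
      using card_common(1)[OF that] that(3) by (simp split: if_splits)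
  qed
  \<comment> \<open>Each genuine common neighbour \<open>z\<close> loses its loop and, if
    \<open>x\<close> and \<open>y\<close> are adjacent, its links to them; the rows of
    \<open>x\<close> and \<open>y\<close> themselves have length \<open>m2\<close>. Corrections are
    added on the left to avoid truncated subtraction.\<close>
  have cT: "card {(z, w). E x z \<and> E y z \<and> E x w \<and> E y w \<and> E z w}
      + card {z. E x z \<and> E y z} * (1 + 2 * of_bool (E x y)) + of_bool (E x y) * (2 * m2)
      = m2 * m3 + of_bool (E x y) * ((q + 1) * (q * e * e))"
    if xy: "x \<in> P" "y \<in> P" "x \<noteq> y" for x y
  proof -
    let ?C = "{z. E x z \<and> E y z}" and ?L = "if E x y then {x, y} else {}"
    have finC: "finite ?C"
      by (rule fin)
    have "{(z, w). E x z \<and> E y z \<and> E x w \<and> E y w \<and> E z w} = (SIGMA z:?C. {w \<in> ?C. E z w})"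
      by auto
    then have 1: "card {(z, w). E x z \<and> E y z \<and> E x w \<and> E y w \<and> E z w}
        = (\<Sum>z\<in>?C. card {w \<in> ?C. E z w})"
      using finC fin(1) by simp
    have row: "card {w \<in> common x y. adj z w} = card {w \<in> ?C. E z w} + (1 + 2 * of_bool (E x y))"
      if z: "z \<in> ?C" for z
    proof -
      have zP: "z \<in> P" "adj z z" "adj z x" "adj z y" "z \<noteq> x" "z \<noteq> y"
        using z adj_refl adj_sym[of x z] adj_sym[of y z] by (auto simp: E)
      have "{w \<in> common x y. adj z w} = {w \<in> ?C. E z w} \<union> insert z ?L"
        unfolding loops(1)[OF xy] using z zP by (auto simp: E)
      moreover have "card ({w \<in> ?C. E z w} \<union> insert z ?L) = card {w \<in> ?C. E z w} + card (insert z ?L)"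
      proof (rule card_Un_disjoint)
        show "finite {w \<in> ?C. E z w}"
          using finC by (rule rev_finite_subset) auto
        show "{w \<in> ?C. E z w} \<inter> insert z ?L = {}"
          by (auto simp: E)
      qed simp
      ultimately have "card {w \<in> common x y. adj z w} = card {w \<in> ?C. E z w} + card (insert z ?L)"
        by (rule trans[OF arg_cong[where f = card]])
      also have "card (insert z ?L) = 1 + 2 * of_bool (E x y)"
        using zP xy by simp
      finally show ?thesis .
    qed
    have end_row: "card {w \<in> common x y. adj z w} = m2" if "z \<in> ?L" for z
    proof -
      have "{w \<in> common x y. adj z w} = common x y"
        using that by (auto simp: common_def split: if_splits)
      then show ?thesis
        using card_common(1)[OF xy] by simp
    qed
    have "sum g (common x y) = sum g ?C + sum g ?L" for g :: "'a \<Rightarrow> nat"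
      unfolding loops(1)[OF xy] by (rule sum.union_disjoint[OF finC _ loops(2)[OF xy]]) simp
    then have "pairs x y = (\<Sum>z\<in>?C. card {w \<in> common x y. adj z w})
        + (\<Sum>z\<in>?L. card {w \<in> common x y. adj z w})"
      unfolding pairs_def .
    also have "(\<Sum>z\<in>?L. card {w \<in> common x y. adj z w}) = of_bool (E x y) * (2 * m2)"
      using end_row xy by simp
    also have "(\<Sum>z\<in>?C. card {w \<in> common x y. adj z w})
        = (\<Sum>z\<in>?C. card {w \<in> ?C. E z w} + (1 + 2 * of_bool (E x y)))"
      by (rule sum.cong[OF refl row])
    also have "\<dots> = (\<Sum>z\<in>?C. card {w \<in> ?C. E z w}) + card ?C * (1 + 2 * of_bool (E x y))"
      by (simp only: sum.distrib sum_constant of_nat_id distrib_left)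
    finally show ?thesis
      using 1 card_common(2)[OF xy] xy by (simp add: E)
  qed
  interpret regular_pairs P E "n2 + q * q * e * n1 - 1" "\<lambda>a. m2 - 2 * of_bool a"
    "\<lambda>a. m2 * m3 + of_bool a * ((q + 1) * (q * e * e)) - of_bool a * (2 * m2)
      - (m2 - 2 * of_bool a) * (1 + 2 * of_bool a)"
  proof
    show "finite P"
      by (rule finite_P)
    show "simple_graph P E"
      using Es unfolding simple_graph_def by (auto simp: E)
    fix x assume x: "x \<in> P"
    have "{z \<in> P. adj x z} = insert x {z. E x z}"
      using x adj_refl by (auto simp: E)
    then show "card {z. E x z} = n2 + q * q * e * n1 - 1"
      using degree[OF x] finite_E by (simp add: E)
    fix y assume y: "y \<in> P" "x \<noteq> y"
    show 1: "card {z. E x z \<and> E y z} = m2 - 2 * of_bool (E x y)"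
      using cC[OF x y] by simp
    show "card {(z, w). E x z \<and> E y z \<and> E x w \<and> E y w \<and> E z w}
      = m2 * m3 + of_bool (E x y) * ((q + 1) * (q * e * e)) - of_bool (E x y) * (2 * m2)
      - (m2 - 2 * of_bool (E x y)) * (1 + 2 * of_bool (E x y))"
      unfolding 1[symmetric] using cT[OF x y] by linarith
  qed
  show ?thesis
    by (rule four_vertex_condition)
qed

end

section \<open>Symplectic spaces over a finite field\<close>

text \<open>The number of points of an \<open>m\<close>-dimensional space over a field with
  \<open>q\<close> elements, written as a sum so that no division occurs.\<close>

definition gauss :: "nat \<Rightarrow> nat \<Rightarrow> nat" where
  "gauss q m = (\<Sum>i<m. q ^ i)"

lemma gauss_0 [simp]: "gauss q 0 = 0"
  by (simp add: gauss_def)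

lemma gauss_Suc: "gauss q (Suc m) = gauss q m + q ^ m"
  by (simp add: gauss_def)

lemma gauss_Suc': "gauss q (Suc m) = q * gauss q m + 1"
proof (induction m)
  case (Suc m)
  have "gauss q (Suc (Suc m)) = (q * gauss q m + 1) + q * q ^ m"
    using Suc gauss_Suc[of q "Suc m"] by simp
  also have "\<dots> = q * gauss q (Suc m) + 1"
    by (simp add: gauss_Suc algebra_simps)
  finally show ?case .
qed (simp add: gauss_def)

lemma gauss_add: "gauss q (m + n) = gauss q m + q ^ m * gauss q n"
  by (induction n) (simp_all add: gauss_Suc power_add gauss_def algebra_simps)

lemma power_eq_gauss:
  assumes "2 \<le> q"
  shows "q ^ m = (q - 1) * gauss q m + 1"
proof (induction m)
  case (Suc m)
  obtain p where "q = Suc p"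
    using assms by (cases q) auto
  with Suc show ?case
    by (simp add: gauss_Suc algebra_simps)
qed (simp add: gauss_def)

lemma gauss_eq_div:
  assumes "2 \<le> q"
  shows "(q ^ m - 1) div (q - 1) = gauss q m"
  using assms by (simp add: power_eq_gauss)

lemma (in vector_space) finite_span:
  assumes "finite (UNIV :: 'a set)" "finite b"
  shows "finite (span b)"
  using assms(2)
proof (induction b rule: finite_induct)
  case (insert a b)
  have "span (insert a b) \<subseteq> (\<lambda>(k, v). scale k a + v) ` (UNIV \<times> span b)"
  proof
    fix x assume "x \<in> span (insert a b)"
    then obtain k where "x - scale k a \<in> span b"
      by (auto simp: span_insert)
    then show "x \<in> (\<lambda>(k, v). scale k a + v) ` (UNIV \<times> span b)"
      by (intro image_eqI[of _ _ "(k, x - scale k a)"]) auto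
  qed
  then show ?case
    using insert.IH assms(1) by (meson finite_SigmaI finite_imageI finite_subset)
qed simp

section \<open>Counting vectors and points over a finite field\<close>

locale finite_vector_space = vector_space scale
  for scale :: "'k::{field,finite} \<Rightarrow> 'v::ab_group_add \<Rightarrow> 'v" +
  fixes q :: nat
  assumes finite_UNIV: "finite (UNIV :: 'v set)"
    and q_def: "q = card (UNIV :: 'k set)"
begin

abbreviation points :: "'v set \<Rightarrow> 'v set set" where "points \<equiv> proj_points scale"

lemma finite_vectors [simp]: "finite (S :: 'v set)"
  by (rule finite_subset[OF subset_UNIV finite_UNIV])

lemma two_le_q: "2 \<le> q"
  using card_mono[of UNIV "{0, 1 :: 'k}"] by (simp add: q_def)

lemma card_span_insert:
  assumes S: "subspace S" and a: "a \<notin> S"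
  shows "card (span (insert a S)) = q * card S"
proof -
  let ?f = "\<lambda>(k, v). scale k a + v"
  have sS: "span S = S"
    using S by (rule span_eq_iff[THEN iffD2])
  have "span (insert a S) = ?f ` (UNIV \<times> S)"
  proof (intro equalityI subsetI)
    fix x assume "x \<in> span (insert a S)"
    then obtain k where "x - scale k a \<in> S"
      by (auto simp: span_insert sS)
    then show "x \<in> ?f ` (UNIV \<times> S)"
      by (intro image_eqI[of _ _ "(k, x - scale k a)"]) auto
  next
    fix x assume "x \<in> ?f ` (UNIV \<times> S)"
    then show "x \<in> span (insert a S)"
      by (auto simp: span_insert sS) (metis add_diff_cancel_left')
  qed
  moreover have "inj_on ?f (UNIV \<times> S)"
  proof (rule inj_onI, clarify)
    fix k v l w assume vw: "v \<in> S" "w \<in> S" and eq: "scale k a + v = scale l a + w"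
    have diff: "scale (k - l) a = w - v"
      using eq by (simp add: scale_left_diff_distrib algebra_simps)
    have "k = l"
    proof (rule ccontr)
      assume "k \<noteq> l"
      then have "a = scale (inverse (k - l)) (w - v)"
        by (simp flip: diff)
      then show False
        using a vw S by (simp add: subspace_scale subspace_diff)
    qed
    with eq show "k = l \<and> v = w"
      by simp
  qed
  ultimately show ?thesis
    by (simp add: card_image card_cartesian_product q_def)
qed

lemma card_span_independent:
  assumes "independent b"
  shows "card (span b) = q ^ card b"
proof -
  have "finite b"
    by simp
  then show ?thesis
    using assms
  proof (induction b rule: finite_induct)
    case (insert a b)
    have "span (insert a b) = span (insert a (span b))"
      by (simp add: span_insert span_span)
    then show ?case
      using insert card_span_insert[of "span b" a] by (simp add: independent_insert)
  qed simp
qed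

lemma card_subspace:
  assumes "subspace S"
  shows "card S = q ^ dim S"
proof -
  obtain b where b: "b \<subseteq> S" "independent b" "S \<subseteq> span b" "card b = dim S"
    by (rule basis_exists)
  then have "span b = S"
    using assms span_minimal by blast
  then show ?thesis
    using card_span_independent[OF b(2)] b(4) by simp
qed

text \<open>From here on dimensions are measured by numbers of vectors.\<close>

lemma dim_eq_iff_card:
  assumes "subspace S"
  shows "dim S = m \<longleftrightarrow> card S = q ^ m"
  using two_le_q by (simp add: card_subspace[OF assms])

lemma finite_vector_sets [simp]: "finite (A :: 'v set set)"
  by (rule finite_subset[OF subset_UNIV]) (simp add: Finite_Set.finite_set finite_UNIV)

lemma mem_points: "x \<in> points S \<longleftrightarrow> subspace x \<and> card x = q \<and> x \<subseteq> S"
  using dim_eq_iff_card[of x 1] by (auto simp: proj_points_def)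

lemma point_eq_span:
  assumes x: "x \<in> points S" and v: "v \<in> x" "v \<noteq> 0"
  shows "x = span {v}"
proof -
  have "span {v} \<subseteq> x"
    using x v by (intro span_minimal) (auto simp: mem_points)
  moreover have "card (span {v}) = q"
    using card_span_independent[of "{v}"] v by simp
  ultimately show ?thesis
    using x by (metis card_subset_eq finite_vectors mem_points)
qed

lemma point_obtain:
  assumes "x \<in> points S"
  obtains v where "v \<in> x" "v \<noteq> 0" "x = span {v}"
proof -
  have "x \<noteq> {0}" "x \<noteq> {}"
    using assms two_le_q by (auto simp: mem_points)
  then obtain v where "v \<in> x" "v \<noteq> 0"
    by blast
  then show ?thesis
    using point_eq_span[OF assms] that by blast
qed

lemma span_in_points: "v \<noteq> 0 \<Longrightarrow> subspace S \<Longrightarrow> v \<in> S \<Longrightarrow> span {v} \<in> points S"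
  using card_span_independent[of "{v}"] by (auto simp: mem_points span_minimal)

lemma points_Int: "points (S \<inter> T) = points S \<inter> points T"
  by (auto simp: mem_points)


lemma points_mono: "S \<subseteq> T \<Longrightarrow> points S \<subseteq> points T"
  unfolding proj_points_def by blast

lemma points_inject:
  assumes "subspace S" "subspace T"
  shows "points S = points T \<longleftrightarrow> S = T"
proof -
  have "S' \<subseteq> T'" if "points S' \<subseteq> points T'" "subspace S'" "subspace T'" for S' T'
  proof
    fix v assume "v \<in> S'"
    then have "v = 0 \<or> span {v} \<in> points T'"
      using span_in_points[OF _ that(2)] that(1) by blast
    then show "v \<in> T'"
      using span_superset[of "{v}"] subspace_0[OF that(3)] by (auto simp: mem_points)
  qed
  then show ?thesis
    using assms by blast
qed

text \<open>The nonzero vectors are partitioned by the points, \<open>q - 1\<close> to each.\<close>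

lemma card_points:
  assumes S: "subspace S"
  shows "(q - 1) * card (points S) + 1 = card S"
proof -
  have 0: "0 \<in> S"
    using S by (rule subspace_0)
  have "S - {0} = (\<Union>x\<in>points S. x - {0})"
  proof (intro equalityI subsetI)
    fix v assume "v \<in> S - {0}"
    then show "v \<in> (\<Union>x\<in>points S. x - {0})"
      using span_in_points[of v S] S span_base[of v "{v}"] by (intro UN_I[of "span {v}"]) auto
  qed (auto simp: mem_points)
  moreover have "card (\<Union>x\<in>points S. x - {0}) = (\<Sum>x\<in>points S. card (x - {0}))"
  proof (rule card_UN_disjoint)
    show "\<forall>x\<in>points S. \<forall>y\<in>points S. x \<noteq> y \<longrightarrow> (x - {0}) \<inter> (y - {0}) = {}"
      using point_eq_span by blast
  qed auto
  moreover have "card (x - {0}) = q - 1" if "x \<in> points S" for x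
    using that subspace_0[of x] by (auto simp: mem_points card_Diff_singleton)
  ultimately have "card (S - {0}) = card (points S) * (q - 1)"
    by simp
  moreover have "card S = card (S - {0}) + 1"
    using card.remove[OF finite_vectors 0] by simp
  ultimately show ?thesis
    by simp
qed

lemma card_points_eq:
  assumes "subspace S" "card S = q ^ m"
  shows "card (points S) = gauss q m"
proof -
  have "(q - 1) * card (points S) = (q - 1) * gauss q m"
    using card_points[OF assms(1)] power_eq_gauss[OF two_le_q, of m] assms(2) by simp
  then show ?thesis
    using two_le_q by simp
qed

lemma card_points_Diff:
  assumes S: "subspace S" "card S = q ^ Suc m" and T: "subspace T" "card (S \<inter> T) = q ^ m"
  shows "card (points S - points T) = q ^ m"
proof -
  have "points S - points T = points S - points (S \<inter> T)"
    by (auto simp: points_Int)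
  moreover have "card (points S - points (S \<inter> T)) = card (points S) - card (points (S \<inter> T))"
    by (rule card_Diff_subset) (auto simp: points_Int)
  ultimately show ?thesis
    using card_points_eq[OF S] card_points_eq[OF _ T(2)] S(1) T(1)
    by (simp add: subspace_inter gauss_Suc)
qed

text \<open>A nonzero functional on \<open>S\<close> takes every value, and its fibres are
  translates of the kernel.\<close>

lemma card_kernel:
  fixes f :: "'v \<Rightarrow> 'k"
  assumes S: "subspace S" and add: "\<And>u v. f (u + v) = f u + f v"
    and scl: "\<And>c v. f (scale c v) = c * f v"
    and s: "s \<in> S" "f s \<noteq> 0"
  shows "q * card {v \<in> S. f v = 0} = card S"
proof -
  have "card S = card {v \<in> S. f v = 0} * card (UNIV :: 'k set)"
  proof (rule card_const_fibres[where h = f])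
    fix c :: 'k
    let ?t = "scale (c / f s) s"
    have t: "?t \<in> S" "f ?t = c"
      using S s by (auto simp: subspace_scale scl)
    have "bij_betw (\<lambda>v. v + ?t) {v \<in> S. f v = 0} {v \<in> S. f v = c}"
    proof (rule bij_betw_byWitness[where f' = "\<lambda>v. v - ?t"])
      have "f (v - ?t) = f v - c" for v
        using add[of "v - ?t" ?t] t by simp
      then show "(\<lambda>v. v - ?t) ` {v \<in> S. f v = c} \<subseteq> {v \<in> S. f v = 0}"
        using S t by (auto intro: subspace_diff)
    qed (use S t add in \<open>auto intro: subspace_add\<close>)
    then show "card {v \<in> S. f v = c} = card {v \<in> S. f v = 0}"
      by (simp add: bij_betw_same_card)
  qed auto
  then show ?thesis
    by (simp add: q_def)
qed

end

text \<open>Here \<open>c\<close> stands for d-2, so that the exponents d, d-1 and d-2 are all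
  successors of \<open>c\<close> or \<open>c\<close> itself.\<close>

locale symplectic_polar_space = finite_vector_space scale q
  for scale :: "'k::{field,finite} \<Rightarrow> 'v::ab_group_add \<Rightarrow> 'v" and q :: nat +
  fixes B :: "'v \<Rightarrow> 'v \<Rightarrow> 'k" and W :: "'v set" and c :: nat
  assumes form: "symplectic_form scale B" and nondeg: "nondegenerate B"
    and subspace_W: "subspace W" and isotropic_W: "totally_isotropic B W"
    and card_W: "card W = q ^ Suc (Suc c)"
    and card_UNIV: "card (UNIV :: 'v set) = q ^ (Suc (Suc c) + Suc (Suc c))"
begin

section \<open>Orthogonal complements\<close>

lemma form_linear:
  "B u (v + w) = B u v + B u w" "B (v + w) u = B v u + B w u"
  "B u (scale a v) = a * B u v" "B (scale a v) u = a * B v u"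
  "B u u = 0" "B u 0 = 0" "B 0 u = 0"
proof -
  have l: "Vector_Spaces.linear scale (*) (\<lambda>y. B x y)" "Vector_Spaces.linear scale (*) (\<lambda>x. B x y)"
    for x y using form by (auto simp: symplectic_form_def)
  note hom = l[THEN Vector_Spaces.linear.axioms(3)]
  show "B u (v + w) = B u v + B u w" "B (v + w) u = B v u + B w u"
    using hom[THEN module_hom.add] by auto
  show scl: "B u (scale a v) = a * B u v" "B (scale a v) u = a * B v u" for a v
    using hom[THEN module_hom.scale] by auto
  show "B u u = 0"
    using form by (simp add: symplectic_form_def)
  show "B u 0 = 0" "B 0 u = 0"
    using scl[of 0 0] by auto
qed

lemma form_eq_0_sym: "B u v = 0 \<longleftrightarrow> B v u = 0"
  using symplectic_form_skew[OF form, of u v] by simp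

definition oc :: "'v set \<Rightarrow> 'v set" where
  "oc S = {v. \<forall>u\<in>S. B u v = 0}"

lemma oc_Un: "oc (S \<union> T) = oc S \<inter> oc T"
  by (auto simp: oc_def)

lemma oc_antimono: "S \<subseteq> T \<Longrightarrow> oc T \<subseteq> oc S"
  by (auto simp: oc_def)

lemma subset_oc_sym: "S \<subseteq> oc T \<longleftrightarrow> T \<subseteq> oc S"
  using form_eq_0_sym by (auto simp: oc_def)

lemma subspace_oc [simp]: "subspace (oc S)"
  by (rule subspaceI) (auto simp: oc_def form_linear)

lemma oc_span: "oc (span S) = oc S"
proof
  show "oc (span S) \<subseteq> oc S"
    by (rule oc_antimono) (rule span_superset)
  have "span S \<subseteq> oc (oc S)"
    by (rule span_minimal) (use subset_oc_sym in auto)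
  then show "oc S \<subseteq> oc (span S)"
    using subset_oc_sym by blast
qed

text \<open>Orthogonal pairs \<open>(s, v)\<close> with \<open>s\<close> in \<open>S\<close> are
  counted twice. By nondegeneracy a nonzero \<open>s\<close> is orthogonal to one in
  \<open>q\<close> vectors; a \<open>v\<close> outside \<open>oc S\<close> is orthogonal to one in
  \<open>q\<close> vectors of \<open>S\<close>. The factor \<open>q - 1\<close> is then
  cancelled.\<close>

lemma card_mult_card_oc:
  assumes S: "subspace S"
  shows "card S * card (oc S) = card (UNIV :: 'v set)"
proof -
  let ?N = "card (UNIV :: 'v set)" and ?C = "card (oc S)"
  obtain p where p: "q = Suc p" "p \<noteq> 0"
    using two_le_q by (cases q) auto
  have left: "q * card {v. B s v = 0} = ?N" if s: "s \<noteq> 0" for s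
  proof -
    obtain v where "B s v \<noteq> 0"
      using nondeg s by (auto simp: nondegenerate_def)
    then show ?thesis
      using card_kernel[of UNIV "B s" v] by (simp add: form_linear)
  qed
  have right: "q * card {s \<in> S. B s v = 0} = card S" if "v \<notin> oc S" for v
    using card_kernel[OF S, of "\<lambda>s. B s v"] that by (auto simp: form_linear oc_def)
  have in_oc: "{s \<in> S. B s v = 0} = S" if "v \<in> oc S" for v
    using that by (auto simp: oc_def)
  have 0: "0 \<in> S"
    using S by (rule subspace_0)
  then have cS: "card S = Suc (card (S - {0}))"
    by (rule card.remove[OF finite_vectors])
  have "q * (\<Sum>s\<in>S. card {v. B s v = 0}) = q * ?N + card (S - {0}) * ?N"
    unfolding sum.remove[OF finite_vectors 0] by (simp add: form_linear left sum_distrib_left distrib_left)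
  moreover have "q * (\<Sum>v\<in>UNIV. card {s \<in> S. B s v = 0}) = q * (?C * card S) + card (- oc S) * card S"
  proof -
    have "(\<Sum>v\<in>UNIV. card {s \<in> S. B s v = 0})
        = (\<Sum>v\<in>oc S. card {s \<in> S. B s v = 0}) + (\<Sum>v\<in>- oc S. card {s \<in> S. B s v = 0})"
      using sum.union_disjoint[of "oc S" "- oc S"] by (simp add: Compl_partition)
    then show ?thesis
      by (simp add: in_oc right sum_distrib_left distrib_left)
  qed
  moreover have "(\<Sum>s\<in>S. card {v. B s v = 0}) = (\<Sum>v\<in>UNIV. card {s \<in> S. B s v = 0})"
    using sum_card_filter_swap[of S UNIV "\<lambda>s v. B s v = 0"] by simp
  moreover have "?N = ?C + card (- oc S)"
    using card_Un_disjoint[of "oc S" "- oc S"] by (simp add: Compl_partition)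
  ultimately have "q * ?N + card (S - {0}) * ?N + ?C * card S = q * (?C * card S) + ?N * card S"
    by (simp add: algebra_simps)
  then have "p * ?N = p * (?C * card S)"
    unfolding p(1) cS by (simp add: algebra_simps)
  then show ?thesis
    using p(2) by (simp add: mult.commute)
qed

lemma card_oc:
  assumes "subspace S" "card S = q ^ m" "m + n = Suc (Suc c) + Suc (Suc c)"
  shows "card (oc S) = q ^ n"
proof -
  have "q ^ m * card (oc S) = q ^ m * q ^ n"
    using card_mult_card_oc[OF assms(1)] assms(2,3) card_UNIV by (simp flip: power_add)
  then show ?thesis
    using two_le_q by simp
qed

section \<open>Joins with a point, and traces on the maximal isotropic subspace\<close>

abbreviation P where "P \<equiv> points UNIV"
abbreviation U where "U \<equiv> points W"
abbreviation join where "join S y \<equiv> span (S \<union> y)"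

definition ort :: "'v set \<Rightarrow> 'v set \<Rightarrow> bool" where
  "ort x y \<longleftrightarrow> (\<forall>u\<in>x. \<forall>v\<in>y. B u v = 0)"

lemma ort_iff: "ort x y \<longleftrightarrow> y \<subseteq> oc x"
  by (auto simp: ort_def oc_def)

lemma oc_join: "oc (join S y) = oc S \<inter> oc y"
  by (simp add: oc_span oc_Un)

lemma card_join:
  assumes S: "subspace S" and y: "y \<in> P" "\<not> y \<subseteq> S"
  shows "card (join S y) = q * card S"
proof -
  obtain b where b: "b \<in> y" "y = span {b}"
    using point_obtain[OF y(1)] by metis
  then have "b \<notin> S"
    using y S span_minimal[of "{b}" S] by auto
  moreover have "join S y = span (insert b S)"
    unfolding b(2) insert_is_Un[of b S] Un_commute[of "{b}"] by (simp only: span_Un span_span)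
  ultimately show ?thesis
    using card_span_insert[OF S] by simp
qed

text \<open>Each point outside the current span cuts the complement by a factor \<open>q\<close>;
  the fibre sizes below follow by adding points one at a time.\<close>

lemma card_oc_Int:
  assumes S: "subspace S" and y: "y \<in> P" "\<not> y \<subseteq> S" and card: "card (oc S) = q ^ Suc m"
  shows "card (oc S \<inter> oc y) = q ^ m"
proof -
  have "q * card S * card (oc S \<inter> oc y) = card S * q ^ Suc m"
    using card_mult_card_oc[of "join S y"] card_mult_card_oc[OF S] card_join[OF S y]
    by (simp add: oc_join card)
  moreover have "card S \<noteq> 0"
    using subspace_0[OF S] by auto
  ultimately show ?thesis
    using two_le_q by simp
qed

text \<open>Total isotropy gives one inclusion, and \<open>W\<close> has half the dimension of the
  whole space.\<close>

lemma oc_W: "oc W = W"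
proof (rule sym, rule card_subset_eq)
  show "W \<subseteq> oc W"
    using isotropic_W by (auto simp: oc_def totally_isotropic_def)
  show "card W = card (oc W)"
    using card_oc[OF subspace_W card_W refl] card_W by simp
qed simp

abbreviation Q where "Q \<equiv> P - U"
abbreviation hyp where "hyp \<equiv> \<lambda>z. {u \<in> U. ort z u}"
abbreviation \<H> where "\<H> \<equiv> hyperplanes scale W"

lemma Q_not_subset: "y \<in> Q \<Longrightarrow> T \<subseteq> W \<Longrightarrow> \<not> y \<subseteq> T"
  by (auto simp: mem_points)

lemma hyp_eq: "hyp z = points (W \<inter> oc z)"
  by (auto simp: mem_points ort_iff)

lemma card_W_oc:
  assumes "y \<in> Q"
  shows "card (W \<inter> oc y) = q ^ Suc c"
  using card_oc_Int[OF subspace_W, of y "Suc c"] assms Q_not_subset[OF assms subset_refl]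
  by (simp add: oc_W card_W)

lemma subspace_W_oc [simp]: "subspace (W \<inter> oc y)"
  by (simp add: subspace_inter subspace_W)

lemma mem_hyperplanes: "H \<in> \<H> \<longleftrightarrow> (\<exists>T. H = points T \<and> subspace T \<and> T \<subseteq> W \<and> card T = q ^ Suc c)"
proof -
  have "dim W = Suc (Suc c)"
    using dim_eq_iff_card[OF subspace_W] card_W by simp
  then have "dim T + 1 = dim W \<longleftrightarrow> card T = q ^ Suc c" if "subspace T" for T
    using dim_eq_iff_card[OF that, of "Suc c"] by auto
  then show ?thesis
    unfolding hyperplanes_def by blast
qed

lemma hyp_in: "z \<in> Q \<Longrightarrow> hyp z \<in> \<H>"
  unfolding mem_hyperplanes hyp_eq using card_W_oc by (intro exI[of _ "W \<inter> oc z"]) simp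

lemma card_hyp: "z \<in> Q \<Longrightarrow> card (hyp z) = gauss q (Suc c)"
  unfolding hyp_eq using card_W_oc by (intro card_points_eq) simp_all

text \<open>Both hyperplanes have equally many vectors, so inclusion suffices. This turns a fibre of
  the trace map into the points of \<open>oc T\<close> off \<open>W\<close>.\<close>

lemma hyp_eq_points_iff:
  assumes z: "z \<in> Q" and T: "subspace T" "T \<subseteq> W" "card T = q ^ Suc c"
  shows "hyp z = points T \<longleftrightarrow> z \<subseteq> oc T"
proof -
  have "W \<inter> oc z = T \<longleftrightarrow> T \<subseteq> oc z"
    using T card_W_oc[OF z] card_subset_eq[of "W \<inter> oc z" T] by auto
  then show ?thesis
    unfolding hyp_eq using points_inject[of "W \<inter> oc z" T] T subset_oc_sym by simp
qed

text \<open>If \<open>z\<close> lay in the join, its perp would contain the trace of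
  \<open>y\<close>, and the two traces would coincide. This is the independence needed for cutting
  by both perps.\<close>

lemma not_in_join:
  assumes y: "y \<in> Q" and z: "z \<in> Q" and yz: "hyp y \<noteq> hyp z"
  shows "\<not> z \<subseteq> join W y"
proof
  assume "z \<subseteq> join W y"
  then have "W \<inter> oc y \<subseteq> oc z"
    using oc_antimono[of z "join W y"] by (simp add: oc_join oc_W)
  then have "hyp z = points (W \<inter> oc y)"
    using hyp_eq_points_iff[OF z, of "W \<inter> oc y"] card_W_oc[OF y] subset_oc_sym by auto
  then show False
    using yz by (simp add: hyp_eq)
qed

lemma card_W_oc_oc:
  assumes "y \<in> Q" "z \<in> Q" "hyp y \<noteq> hyp z"
  shows "card (W \<inter> oc y \<inter> oc z) = q ^ c"
  using card_oc_Int[of "join W y" z c] not_in_join[OF assms] assms card_W_oc[of y]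
  by (simp add: oc_join oc_W)

lemma card_hyp_Int:
  assumes "y \<in> Q" "z \<in> Q" "hyp y \<noteq> hyp z"
  shows "card (hyp y \<inter> hyp z) = gauss q c"
proof -
  have "hyp y \<inter> hyp z = points (W \<inter> oc y \<inter> oc z)"
    unfolding hyp_eq points_Int by blast
  then show ?thesis
    using card_W_oc_oc[OF assms] by (simp add: card_points_eq subspace_inter subspace_W)
qed

lemma hyperplane_cases:
  assumes "H \<in> \<H>"
  obtains T where "H = points T" "subspace T" "T \<subseteq> W" "card T = q ^ Suc c" "W \<subseteq> oc T"
    "card (oc T) = q ^ Suc (Suc (Suc c))"
proof -
  obtain T where T: "H = points T" "subspace T" "T \<subseteq> W" "card T = q ^ Suc c"
    using assms by (auto simp: mem_hyperplanes)
  moreover have "W \<subseteq> oc T"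
    using oc_antimono[OF T(3)] oc_W by simp
  moreover have "card (oc T) = q ^ Suc (Suc (Suc c))"
    by (rule card_oc[OF T(2,4)]) simp
  ultimately show ?thesis
    using that by blast
qed

text \<open>The fibre is the difference of spaces of dimension \<open>c + 3\<close> and
  \<open>c + 2\<close>. In the next two lemmas the perps of \<open>y\<close> and \<open>z\<close>
  each lower both dimensions by one.\<close>

lemma fibre0:
  assumes "H \<in> \<H>"
  shows "card {z \<in> Q. hyp z = H} = q * q * q ^ c"
  using assms
proof (cases rule: hyperplane_cases)
  case (1 T)
  have "{z \<in> Q. hyp z = H} = {z \<in> Q. z \<subseteq> oc T}"
    unfolding 1(1) using hyp_eq_points_iff[OF _ 1(2-4)] by (intro Collect_cong conj_cong refl)
  also have "\<dots> = points (oc T) - points W"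
    by (auto simp: mem_points)
  finally show ?thesis
    using card_points_Diff[of "oc T" "Suc (Suc c)" W] 1(5,6) card_W subspace_W by (simp add: Int_absorb1)
qed

lemma fibre1:
  assumes "H \<in> \<H>" and y: "y \<in> Q"
  shows "card {z \<in> Q. ort y z \<and> hyp z = H} = q * q ^ c"
  using assms(1)
proof (cases rule: hyperplane_cases)
  case (1 T)
  have "\<not> y \<subseteq> T"
    by (rule Q_not_subset[OF y 1(3)])
  then have "card (oc T \<inter> oc y) = q ^ Suc (Suc c)"
    using y 1 by (intro card_oc_Int) auto
  moreover have "oc T \<inter> oc y \<inter> W = W \<inter> oc y"
    using 1(5) by blast
  moreover have "{z \<in> Q. ort y z \<and> hyp z = H} = points (oc T \<inter> oc y) - points W"
  proof -
    have "{z \<in> Q. ort y z \<and> hyp z = H} = {z \<in> Q. ort y z \<and> z \<subseteq> oc T}"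
      unfolding 1(1) using hyp_eq_points_iff[OF _ 1(2-4)]
      by (intro Collect_cong conj_cong refl)
    also have "\<dots> = points (oc T \<inter> oc y) - points W"
      by (auto simp: mem_points ort_iff)
    finally show ?thesis .
  qed
  ultimately show ?thesis
    using card_points_Diff[of "oc T \<inter> oc y" "Suc c" W] card_W_oc[OF y] subspace_W
    by (simp add: subspace_inter)
qed

lemma fibre2:
  assumes "H \<in> \<H>" and y: "y \<in> Q" and z: "z \<in> Q" and yz: "hyp y \<noteq> hyp z"
  shows "card {w \<in> Q. ort y w \<and> ort z w \<and> hyp w = H} = q ^ c"
  using assms(1)
proof (cases rule: hyperplane_cases)
  case (1 T)
  have y': "\<not> y \<subseteq> T"
    by (rule Q_not_subset[OF y 1(3)])
  have "join T y \<subseteq> join W y"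
    using 1(3) by (intro span_mono) auto
  then have z': "\<not> z \<subseteq> join T y"
    using not_in_join[OF y z yz] by blast
  have "card (oc (join T y)) = q ^ Suc (Suc c)"
    unfolding oc_join using y y' 1 by (intro card_oc_Int) auto
  then have "card (oc (join T y) \<inter> oc z) = q ^ Suc c"
    using z z' by (intro card_oc_Int) auto
  then have "card (oc T \<inter> oc y \<inter> oc z) = q ^ Suc c"
    by (simp only: oc_join)
  moreover have "oc T \<inter> oc y \<inter> oc z \<inter> W = W \<inter> oc y \<inter> oc z"
    using 1(5) by blast
  moreover have "{w \<in> Q. ort y w \<and> ort z w \<and> hyp w = H} = points (oc T \<inter> oc y \<inter> oc z) - points W"
  proof -
    have "{w \<in> Q. ort y w \<and> ort z w \<and> hyp w = H} = {w \<in> Q. ort y w \<and> ort z w \<and> w \<subseteq> oc T}"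
      unfolding 1(1) using hyp_eq_points_iff[OF _ 1(2-4)]
      by (intro Collect_cong conj_cong refl)
    also have "\<dots> = points (oc T \<inter> oc y \<inter> oc z) - points W"
      by (auto simp: mem_points ort_iff)
    finally show ?thesis .
  qed
  ultimately show ?thesis
    using card_points_Diff[of "oc T \<inter> oc y \<inter> oc z" c W] card_W_oc_oc[OF y z yz] subspace_W
    by (simp add: subspace_inter)
qed

lemma ort_sym: "ort x y \<longleftrightarrow> ort y x"
  by (simp add: ort_iff subset_oc_sym)

lemma ort_refl:
  assumes "x \<in> P"
  shows "ort x x"
proof -
  obtain v where "x = span {v}"
    using point_obtain[OF assms] by metis
  then show ?thesis
    by (auto simp: ort_def span_singleton form_linear)
qed

text \<open>The join of \<open>hyp y\<close> and \<open>y\<close> is a maximal totally isotropic subspace.\<close>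

lemma ort_trans:
  assumes y: "y \<in> Q" and z: "z \<in> Q" and w: "w \<in> Q" and hyp: "hyp y = hyp z" "hyp y = hyp w"
    and ort: "ort y z" "ort y w"
  shows "ort z w"
proof -
  let ?T = "W \<inter> oc y"
  let ?S = "join ?T y"
  have T: "subspace ?T" "?T \<subseteq> W" "card ?T = q ^ Suc c"
    using card_W_oc[OF y] by auto
  have "z \<subseteq> oc ?T" "w \<subseteq> oc ?T"
    using hyp_eq_points_iff[OF z T] hyp_eq_points_iff[OF w T] hyp by (simp_all add: hyp_eq)
  then have zw: "z \<subseteq> oc ?S" "w \<subseteq> oc ?S"
    using ort by (auto simp: oc_join ort_iff)
  have "?S = oc ?S"
  proof (rule card_subset_eq)
    have "?T \<subseteq> oc ?T"
      using oc_antimono[OF T(2)] by (auto simp: oc_W)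
    moreover have "y \<subseteq> oc ?T"
      using subset_oc_sym[of y ?T] by simp
    moreover have "y \<subseteq> oc y"
      using ort_refl y by (simp add: ort_iff)
    ultimately show "?S \<subseteq> oc ?S"
      by (intro span_minimal) (auto simp: oc_join subspace_inter)
    have "card ?S = q ^ Suc (Suc c)"
      using card_join[OF T(1) _ Q_not_subset[OF y T(2)]] y T(3) by simp
    then show "card ?S = card (oc ?S)"
      using card_oc[of ?S "Suc (Suc c)" "Suc (Suc c)"] by simp
  qed simp
  then have "z \<subseteq> oc (oc ?S)"
    using zw by simp
  then show ?thesis
    using zw oc_antimono subset_oc_sym by (metis ort_iff order_trans)
qed

section \<open>Common perps in the polar space\<close>

lemma card_oc_point:
  assumes "x \<in> P"
  shows "card (oc x) = q ^ Suc (c + Suc (Suc c))"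
  by (rule card_oc[of x 1]) (use assms in \<open>auto simp: mem_points\<close>)

lemma points_nested:
  assumes "x \<in> P" "y \<in> P" "y \<subseteq> x"
  shows "x = y"
  using assms card_subset_eq[of x y] by (auto simp: mem_points)

lemma ort2_eq: "{z \<in> P. ort x z \<and> ort y z} = points (oc (join x y))"
  by (auto simp: mem_points ort_iff oc_join)

lemma card_oc_line:
  assumes "x \<in> P" "y \<in> P" "x \<noteq> y"
  shows "card (oc (join x y)) = q ^ Suc (Suc c + c)"
  unfolding oc_join
proof (rule card_oc_Int)
  show "subspace x"
    using assms by (simp add: mem_points)
  show "\<not> y \<subseteq> x"
    using points_nested[of x y] assms by blast
qed (use assms card_oc_point[of x] in simp_all)

lemma card_ort2:
  assumes "x \<in> P" "y \<in> P" "x \<noteq> y"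
  shows "card {z \<in> P. ort x z \<and> ort y z} = gauss q (Suc c) + q * q ^ c * gauss q (Suc c)"
proof -
  have "card (points (oc (join x y))) = gauss q (Suc c + Suc c)"
    using card_oc_line[OF assms] by (intro card_points_eq) simp_all
  then show ?thesis
    unfolding ort2_eq by (simp only: gauss_add power_Suc)
qed

text \<open>These are the points of the radical of the join: the whole line if it is totally
  isotropic, none if it is hyperbolic.\<close>

lemma card_ort_line_points:
  assumes x: "x \<in> P" and y: "y \<in> P" and xy: "x \<noteq> y"
  shows "card {z \<in> points (oc (join x y)). z \<subseteq> join x y} = of_bool (ort x y) * (q + 1)"
proof (cases "ort x y")
  case True
  have "join x y \<subseteq> oc (join x y)"
    using True ort_refl[OF x] ort_refl[OF y] ort_sym[of x y]
    by (intro span_minimal) (auto simp: oc_join ort_iff subspace_inter)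
  then have "{z \<in> points (oc (join x y)). z \<subseteq> join x y} = points (join x y)"
    unfolding set_eq_iff mem_Collect_eq mem_points by blast
  moreover have "card (points (join x y)) = gauss q 2"
  proof (rule card_points_eq)
    have "\<not> y \<subseteq> x"
      using points_nested[of x y] assms by blast
    then show "card (join x y) = q ^ 2"
      using card_join[of x y] x y by (simp add: mem_points power2_eq_square)
  qed simp
  ultimately show ?thesis
    using True by (simp add: numeral_2_eq_2 gauss_Suc)
next
  case False
  obtain a b where a: "x = span {a}" "a \<in> x" and b: "y = span {b}" "b \<in> y"
    using point_obtain[OF x] point_obtain[OF y] by metis
  have ab: "B a b \<noteq> 0" "B b a \<noteq> 0"
    using False form_eq_0_sym[of a b] by (auto simp: ort_def a(1) b(1) span_singleton form_linear)
  \<comment> \<open>Pairing \<open>k a + l b\<close> with \<open>a\<close> kills \<open>l\<close>,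
    and pairing it with \<open>b\<close> kills \<open>k\<close>.\<close>
  have rad: "join x y \<inter> oc (join x y) \<subseteq> {0}"
  proof
    fix v assume "v \<in> join x y \<inter> oc (join x y)"
    then have "v \<in> join x y" "v \<in> oc x" "v \<in> oc y"
      by (simp_all add: oc_join)
    then have v: "v \<in> join x y" "B a v = 0" "B b v = 0"
      using a(2) b(2) by (simp_all add: oc_def)
    have "span x = range (\<lambda>k. scale k a)" "span y = range (\<lambda>k. scale k b)"
      unfolding a(1) b(1) span_span by (rule span_singleton)+
    with v(1) obtain k l where "v = scale k a + scale l b"
      by (auto simp: span_Un)
    with v ab show "v \<in> {0}"
      by (simp add: form_linear)
  qed
  have "\<not> z \<subseteq> join x y" if z: "z \<in> points (oc (join x y))" for z
  proof
    assume sub: "z \<subseteq> join x y"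
    obtain v where "v \<in> z" "v \<noteq> 0" "z = span {v}"
      by (rule point_obtain[OF z])
    moreover have "z \<subseteq> oc (join x y)"
      using z by (simp add: mem_points)
    ultimately show False
      using sub rad by blast
  qed
  then have "{z \<in> points (oc (join x y)). z \<subseteq> join x y} = {}"
    by blast
  then show ?thesis
    using False by simp
qed

text \<open>The perp of \<open>z\<close> cuts \<open>oc ?L\<close> in a hyperplane unless
  \<open>z\<close> lies on the line \<open>?L\<close>, where it contains all of
  \<open>oc ?L\<close>; such a \<open>z\<close> adds \<open>q ^ (Suc c + c)\<close> points.\<close>

lemma ort_pairs:
  assumes x: "x \<in> P" and y: "y \<in> P" and xy: "x \<noteq> y"
  shows "(\<Sum>z | z \<in> P \<and> ort x z \<and> ort y z. card {w \<in> P. ort x w \<and> ort y w \<and> ort z w})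
    = (gauss q (Suc c) + q * q ^ c * gauss q (Suc c)) * (gauss q (Suc c) + q * q ^ c * gauss q c)
      + of_bool (ort x y) * ((q + 1) * (q * q ^ c * q ^ c))"
proof -
  let ?L = "join x y"
  let ?m2 = "gauss q (Suc c + Suc c)" and ?m3 = "gauss q (Suc c + c)"
  have oL: "card (oc ?L) = q ^ Suc (Suc c + c)"
    by (rule card_oc_line[OF x y xy])
  have row: "card {w \<in> P. ort x w \<and> ort y w \<and> ort z w} = ?m3 + of_bool (z \<subseteq> ?L) * q ^ (Suc c + c)"
    if z: "z \<in> points (oc ?L)" for z
  proof -
    have eq: "{w \<in> P. ort x w \<and> ort y w \<and> ort z w} = points (oc ?L \<inter> oc z)"
      by (auto simp: mem_points ort_iff oc_join)
    show ?thesis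
    proof (cases "z \<subseteq> ?L")
      case True
      then have "oc ?L \<inter> oc z = oc ?L"
        using oc_antimono by blast
      then show ?thesis
        using True card_points_eq[OF subspace_oc oL] by (simp add: eq gauss_Suc)
    next
      case False
      then have "card (oc ?L \<inter> oc z) = q ^ (Suc c + c)"
        using z oL by (intro card_oc_Int) (auto simp: mem_points)
      then show ?thesis
        using False by (simp add: eq card_points_eq subspace_inter)
    qed
  qed
  have "(\<Sum>z | z \<in> P \<and> ort x z \<and> ort y z. card {w \<in> P. ort x w \<and> ort y w \<and> ort z w})
      = (\<Sum>z\<in>points (oc ?L). ?m3 + of_bool (z \<subseteq> ?L) * q ^ (Suc c + c))"
    unfolding ort2_eq by (rule sum.cong[OF refl row])
  also have "\<dots> = card (points (oc ?L)) * ?m3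
      + card {z \<in> points (oc ?L). z \<subseteq> ?L} * q ^ (Suc c + c)"
    by (simp add: sum.distrib Int_def flip: sum_distrib_right)
  also have "card (points (oc ?L)) = ?m2"
    using card_points_eq[OF subspace_oc oL] by simp
  finally show ?thesis
    unfolding card_ort_line_points[OF assms] by (simp only: gauss_add power_add power_Suc mult.assoc)
qed

end

section \<open>The graph of a twisted symplectic polar space\<close>

theorem proposition7p8:
  fixes scale :: "'k::{field,finite} \<Rightarrow> 'v::ab_group_add \<Rightarrow> 'v"
    and B :: "'v \<Rightarrow> 'v \<Rightarrow> 'k"
    and W :: "'v set"
    and U :: "'v set set"
    and Blocks :: "'v set set set"
    and \<phi> :: "'v set set \<Rightarrow> 'v set set"
    and d q :: nat
  assumes "d \<ge> 3"
    and "q = card (UNIV :: 'k set)"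
    and "vector_space scale"
    and "vector_space.dim scale (UNIV :: 'v set) = 2 * d"
    and "symplectic_form scale B"
    and "nondegenerate B"
    and "module.subspace scale W"
    and "vector_space.dim scale W = d"
    and "totally_isotropic B W"
    and "U = proj_points scale W"
    and "symmetric_design U Blocks
           ((q ^ d - 1) div (q - 1)) ((q ^ (d - 1) - 1) div (q - 1)) ((q ^ (d - 2) - 1) div (q - 1))"
    and "bij_betw \<phi> (hyperplanes scale W) Blocks"
  shows "vertex_condition 4 (proj_points scale UNIV) (Gamma_adj scale B U \<phi>)"
proof -
  interpret vector_space scale
    by (rule assms(3))
  obtain c where c: "d = Suc (Suc c)" "1 \<le> c"
    using assms(1) by (metis Suc_le_D Suc_le_mono numeral_3_eq_3 One_nat_def)
  have "finite (UNIV :: 'v set)"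
  proof -
    obtain b where b: "independent b" "UNIV \<subseteq> span b" "card b = dim UNIV"
      using basis_exists[of UNIV] by metis
    \<comment> \<open>An infinite \<open>b\<close> would have \<open>card\<close> 0, whereas the
      dimension is positive.\<close>
    then have "finite b"
      using assms(1,4) card_ge_0_finite[of b] by simp
    then have "finite (span b)"
      by (rule finite_span[OF finite])
    then show ?thesis
      using b(2) finite_subset by blast
  qed
  then interpret finite_vector_space scale q
    using assms(2) by unfold_locales
  interpret symplectic_polar_space scale q B W c
    using assms(4-9) card_subspace[of W] card_subspace[of UNIV] c(1)
    by unfold_locales (simp_all add: mult_2)
  have design: "symmetric_design (points W) Blocks (gauss q d) (gauss q (Suc c)) (gauss q c)"
    using assms(11) unfolding gauss_eq_div[OF two_le_q] assms(10) by (simp add: c(1))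
  obtain c' where c': "c = Suc c'"
    using c(2) by (cases c) auto
  \<comment> \<open>Here \<open>d \<ge> 3\<close> enters: the blocks have more than one point, so
    \<open>k - 1\<close> can be cancelled in the replication count.\<close>
  have k: "1 < gauss q (Suc c)"
    using two_le_q by (simp add: gauss_Suc' c')
  have lv: "gauss q c * (gauss q d - 1) = gauss q (Suc c) * (gauss q (Suc c) - 1)"
    by (simp add: gauss_Suc' c(1) algebra_simps)
  note dual = symmetric_design_dual[OF design k lv]
  have Blocks: "finite Blocks" "card Blocks = gauss q d"
      "\<And>b. b \<in> Blocks \<Longrightarrow> b \<subseteq> points W \<and> card b = gauss q (Suc c)"
      "\<And>x y. x \<in> points W \<Longrightarrow> y \<in> points W \<Longrightarrow> x \<noteq> y \<Longrightarrow> card {b \<in> Blocks. x \<in> b \<and> y \<in> b} = gauss q c"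
    using design two_design_finite_blocks[of "points W" Blocks]
    by (auto simp: symmetric_design_def two_design_def)
  have inj: "inj_on \<phi> \<H>" and img: "\<phi> ` \<H> = Blocks"
    using assms(12) by (auto simp: bij_betw_def)
  have in_Blocks: "\<phi> H \<in> Blocks" if "H \<in> \<H>" for H
    using that img by blast
  \<comment> \<open>Counts of blocks become counts of hyperplanes, since \<phi> is a
    bijection.\<close>
  have card_pull: "card {H \<in> \<H>. p (\<phi> H)} = card {b \<in> Blocks. p b}" for p
  proof (rule bij_betw_same_card)
    show "bij_betw \<phi> {H \<in> \<H>. p (\<phi> H)} {b \<in> Blocks. p b}"
      using inj unfolding bij_betw_def img[symmetric] by (auto intro: inj_on_subset)
  qed
  interpret tw: twisted_polar_space P "points W" ort \<H> \<phi> hyp Q q "gauss q c" "gauss q (Suc c)"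
    "gauss q d" "q ^ c" "gauss q (Suc c) + q * q ^ c * gauss q (Suc c)"
    "gauss q (Suc c) + q * q ^ c * gauss q c"
  proof unfold_locales
    show "points W \<subseteq> P"
      by (rule points_mono) simp
    show "0 < q" "0 < q ^ c"
      using two_le_q by simp_all
    show "gauss q d = gauss q (Suc c) + q * q ^ c"
      by (simp add: c(1) gauss_Suc)
    show "card (points W) = gauss q d"
      using card_points_eq[OF subspace_W card_W] c(1) by simp
    show "card \<H> = gauss q d"
      using card_pull[of "\<lambda>_. True"] Blocks(2) by simp
    fix H assume H: "H \<in> \<H>"
    show "H \<subseteq> points W"
      using H by (cases rule: hyperplane_cases) (simp add: points_mono)
    show "\<phi> H \<subseteq> points W" "card (\<phi> H) = gauss q (Suc c)"
      using Blocks(3)[OF in_Blocks[OF H]] by auto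
    fix H' assume "H' \<in> \<H>" "H \<noteq> H'"
    then show "card (\<phi> H \<inter> \<phi> H') = gauss q c"
      using H inj in_Blocks by (intro dual(2)) (auto simp: inj_on_def)
  next
    fix x y assume "x \<in> points W" "y \<in> points W"
    then have "x \<subseteq> W" "y \<subseteq> W"
      by (simp_all add: mem_points)
    then show "ort x y"
      using isotropic_W unfolding ort_def totally_isotropic_def by blast
  next
    fix x y assume "x \<in> points W" "y \<in> points W" "x \<noteq> y"
    then show "card {H \<in> \<H>. x \<in> \<phi> H \<and> y \<in> \<phi> H} = gauss q c"
      using card_pull[of "\<lambda>b. x \<in> b \<and> y \<in> b"] Blocks(4) by simp
  next
    fix x assume "x \<in> points W"
    then show "card {H \<in> \<H>. x \<in> \<phi> H} = gauss q (Suc c)"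
      using card_pull[of "\<lambda>b. x \<in> b"] dual(1) by simp
  qed (rule finite_vector_sets gauss_Suc gauss_Suc' ort_sym ort_refl hyp_in card_hyp card_hyp_Int
      fibre0 fibre1 fibre2 ort_trans card_ort2 ort_pairs; assumption)+
  show ?thesis
  proof (rule tw.four_vertex_condition_adj)
    fix x y
    have hyp: "perp scale B z \<inter> U = hyp z" for z
      using assms(10) by (auto simp: perp_def ort_def mem_points)
    have "x \<in> perp scale B y \<longleftrightarrow> ort x y" if "x \<in> P"
      using that ort_sym[of x y] by (simp add: perp_def ort_def)
    then show "Gamma_adj scale B U \<phi> x y \<longleftrightarrow> x \<in> P \<and> y \<in> P \<and> x \<noteq> y \<and> tw.adj x y"
      unfolding Gamma_adj_def hyp tw.adj_def unfolding assms(10) by auto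
  qed
qed

end
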